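(* Let $\epsilon>0$, $0<\delta<1$, and let $\mathcal G$ be a stable causal single-input single-output linear time-invariant filter. For a stable, minimum phase filter $\mathcal G_1$ let $$e^{ZFE}_{mse}=\kappa(\delta,\epsilon)^2\,\|\mathcal G_1\|_2^2\,\|\mathcal G\mathcal G_1^{-1}\|_2^2$$ be the mean-squared error of the zero forcing equalization (ZFE) mechanism associated with $\mathcal G_1$. Then: (1) For any stable, minimum phase system $\mathcal G_1$, $$e^{ZFE}_{mse}\ge\kappa(\delta,\epsilon)^2\left(\frac1{2\pi}\int_{-\pi}^{\pi}|\mathcal G(e^{j\omega})|\,d\omega\right)^2 .$$ (2) This lower bound is attained by letting $|\mathcal G_1(e^{j\omega})|^2=\lambda|\mathcal G(e^{j\omega})|$ for all $\omega\in[-\pi,\pi)$, where $\lambda$ is an arbitrary positive number. (3) The lower bound can be approached arbitrarily closely by stable, rational, minimum phase transfer functions $\mathcal G_1$: for every $\eta>0$ there is such a $\mathcal G_1$ whose $e^{ZFE}_{mse}$ exceeds the lower bound by at most $\eta$.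
   Context: The $\mathcal H_2$ norm of a single-input single-output transfer function is $\|\mathcal G\|_2=\left(\frac1{2\pi}\int_{-\pi}^{\pi}|\mathcal G(e^{j\omega})|^2d\omega\right)^{1/2}$, so that $$\|\mathcal G_1\|_2^2\,\|\mathcal G\mathcal G_1^{-1}\|_2^2=\frac1{4\pi^2}\int_{-\pi}^\pi|\mathcal G_1(e^{j\omega})|^2d\omega\int_{-\pi}^\pi\left|\frac{\mathcal G(e^{j\omega})}{\mathcal G_1(e^{j\omega})}\right|^2d\omega$$ (possibly $+\infty$). A minimum phase filter is in particular causally invertible. $\mathcal Q(x)=\frac1{\sqrt{2\pi}}\int_x^\infty e^{-u^2/2}du$ and $\kappa(\delta,\epsilon)=\frac1{2\epsilon}\left(K+\sqrt{K^2+2\epsilon}\right)$ with $K=\mathcal Q^{-1}(\delta)$. ZFE mechanism: an integer-valued input signal $u$ is filtered by $\mathcal G_1$; white Gaussian noise $w$ with standard deviation $\sigma=\kappa(\delta,\epsilon)\|\mathcal G_1\|_2$ is added, and the result is passed through $\mathcal G_2=\mathcal G\mathcal G_1^{-1}$, giving the released output $\mathcal Gu+\mathcal G\mathcal G_1^{-1}w$ as an approximation of $\mathcal Gu$. Its mean-squared error is $\lim_{T\to\infty}\frac1T\sum_{t=0}^{T-1}\mathbb E\left[|(\mathcal G\mathcal G_1^{-1}w)_t|^2\right]=\kappa(\delta,\epsilon)^2\|\mathcal G_1\|_2^2\|\mathcal G\mathcal G_1^{-1}\|_2^2$. *)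

theory Defs
  imports "HOL-Analysis.Analysis" "HOL-Computational_Algebra.Polynomial"
begin

text \<open>
  A discrete-time single-input single-output filter is represented by its transfer function
  \<open>G :: complex \<Rightarrow> complex\<close>; only its values on \<open>norm z \<ge> 1\<close> matter. The filter is causal if
  \<open>G z = (\<Sum>k. g k * z ^ -k)\<close> on \<open>norm z > 1\<close> for a real impulse response \<open>g\<close> supported
  on the nonnegative integers.
\<close>

definition causal :: "(complex \<Rightarrow> complex) \<Rightarrow> bool" where
  "causal G \<longleftrightarrow>
     (\<exists>g :: nat \<Rightarrow> real. \<forall>z. norm z > 1 \<longrightarrow> (\<lambda>k. of_real (g k) / z ^ k) sums G z)"

text \<open>
  Stability: the transfer function extends continuously to the unit circle, so that the frequency
  response \<open>\<omega> \<mapsto> G (cis \<omega>)\<close> is defined for every \<open>\<omega>\<close>. Every BIBO stable filter (absolutely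
  summable impulse response) is stable in this sense, see \<open>stable_causal_if_BIBO\<close> below; for
  rational transfer functions the two notions agree (all poles in the open unit disc).
\<close>

definition stable_causal :: "(complex \<Rightarrow> complex) \<Rightarrow> bool" where
  "stable_causal G \<longleftrightarrow> causal G \<and> continuous_on {z. norm z \<ge> 1} G"

text \<open>
  Minimum phase: no zeros outside the closed unit disc, and the inverse is causal (which also
  excludes a zero at infinity). Zeros on the unit circle are allowed, so the inverse need not be
  stable.
\<close>

definition minimum_phase :: "(complex \<Rightarrow> complex) \<Rightarrow> bool" where
  "minimum_phase G \<longleftrightarrow>
     causal G \<and> (\<forall>z. norm z > 1 \<longrightarrow> G z \<noteq> 0) \<and> causal (\<lambda>z. 1 / G z)"

definition rational_tf :: "(complex \<Rightarrow> complex) \<Rightarrow> bool" where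
  "rational_tf G \<longleftrightarrow>
     (\<exists>p q :: real poly. \<forall>z. norm z \<ge> 1 \<longrightarrow>
        poly (map_poly of_real q) z \<noteq> 0 \<and>
        G z = poly (map_poly of_real p) z / poly (map_poly of_real q) z)"

definition ennreal_sqrt :: "ennreal \<Rightarrow> ennreal" where
  "ennreal_sqrt x = (if x = \<infinity> then \<infinity> else ennreal (sqrt (enn2real x)))"

definition h2_norm :: "(complex \<Rightarrow> complex) \<Rightarrow> ennreal" where
  "h2_norm G =
     ennreal_sqrt (ennreal (1 / (2 * pi)) *
       (\<integral>\<^sup>+\<omega>\<in>{-pi..pi}. ennreal ((cmod (G (cis \<omega>)))\<^sup>2) \<partial>lborel))"

definition gaussian_Q :: "real \<Rightarrow> real" where
  "gaussian_Q x = 1 / sqrt (2 * pi) * (LBINT u:{x..}. exp (- u\<^sup>2 / 2))"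

definition kappa :: "real \<Rightarrow> real \<Rightarrow> real" where
  "kappa \<delta> \<epsilon> = (let K = inv gaussian_Q \<delta> in 1 / (2 * \<epsilon>) * (K + sqrt (K\<^sup>2 + 2 * \<epsilon>)))"

text \<open>
  The quotient \<open>G z / G1 z\<close> has the junk value 0 where \<open>G1 z = 0\<close>. For a stable minimum phase
  \<open>G1\<close> this only happens on a null subset of the unit circle, so \<open>h2_norm\<close> does not depend on it.
\<close>

definition zfe_mse ::
    "real \<Rightarrow> real \<Rightarrow> (complex \<Rightarrow> complex) \<Rightarrow> (complex \<Rightarrow> complex) \<Rightarrow> ennreal" where
  "zfe_mse \<delta> \<epsilon> G G1 =
     ennreal ((kappa \<delta> \<epsilon>)\<^sup>2) * (h2_norm G1)\<^sup>2 * (h2_norm (\<lambda>z. G z / G1 z))\<^sup>2"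

definition zfe_bound :: "real \<Rightarrow> real \<Rightarrow> (complex \<Rightarrow> complex) \<Rightarrow> real" where
  "zfe_bound \<delta> \<epsilon> G =
     (kappa \<delta> \<epsilon>)\<^sup>2 * (1 / (2 * pi) * (LBINT \<omega>:{-pi..pi}. cmod (G (cis \<omega>))))\<^sup>2"

lemma ennreal_sqrt_power2: "(ennreal_sqrt x)\<^sup>2 = x"
  by (cases x) (auto simp: ennreal_sqrt_def ennreal_power)

lemma stable_causal_if_BIBO:
  fixes g :: "nat \<Rightarrow> real"
  assumes "summable (\<lambda>k. \<bar>g k\<bar>)"
  shows "stable_causal (\<lambda>z. \<Sum>k. of_real (g k) / z ^ k)"
proof -
  have bound: "norm (of_real (g k) / z ^ k) \<le> \<bar>g k\<bar>" if "norm z \<ge> 1" for k and z :: complex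
  proof -
    have "1 \<le> norm z ^ k"
      using that by (rule one_le_power)
    then show ?thesis
      using divide_left_mono[of 1 "norm z ^ k" "\<bar>g k\<bar>"]
      by (simp add: norm_divide norm_power)
  qed
  have "(\<lambda>k. of_real (g k) / z ^ k) sums (\<Sum>k. of_real (g k) / z ^ k)"
    if "norm z > 1" for z :: complex
    using that bound
    by (intro summable_sums summable_comparison_test[OF _ assms]) (auto intro: less_imp_le)
  moreover have "continuous_on {z. norm z \<ge> 1} (\<lambda>z::complex. \<Sum>k. of_real (g k) / z ^ k)"
  proof (rule uniform_limit_theorem)
    show "uniform_limit {z. norm z \<ge> 1} (\<lambda>n (z::complex). \<Sum>k<n. of_real (g k) / z ^ k)
            (\<lambda>z. \<Sum>k. of_real (g k) / z ^ k) sequentially"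
      using bound assms by (intro Weierstrass_m_test) auto
    show "\<forall>\<^sub>F n in sequentially.
            continuous_on {z. norm z \<ge> 1} (\<lambda>z::complex. \<Sum>k<n. of_real (g k) / z ^ k)"
      by (intro always_eventually allI continuous_intros) auto
  qed auto
  ultimately show ?thesis
    unfolding stable_causal_def causal_def by blast
qed

end

theory Submission
  imports Defs "HOL-Complex_Analysis.Complex_Analysis"
    "HOL-Computational_Algebra.Fundamental_Theorem_Algebra"
begin

text \<open>
  Substituting \<open>z = 1 / w\<close> turns stable causal filters into functions \<open>F\<close> in the disc algebra with real
  Taylor coefficients. The lower bound is the Cauchy--Schwarz inequality; it needs that the zeros of a
  minimum phase filter on the circle form a null set, which holds because the circle averages of the
  harmonic function \<open>ln (cmod F)\<close> cannot tend to \<open>-\<infinity>\<close>.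

  For the optimal filter one needs the square root of the outer factor of \<open>F\<close>, continuous up to the
  boundary. Approximate \<open>F\<close> uniformly by polynomials \<open>p n = q n * B n\<close> with \<open>B n\<close> a finite Blaschke product
  and \<open>q n\<close> zero-free in the disc. By Montel and Hurwitz a subsequence of \<open>q n\<close> converges to a zero-free \<open>h\<close>.
  At a boundary zero of \<open>F\<close>, \<open>h\<close> tends to 0 by the maximum principle with a peaking function; at other
  boundary points the \<open>B n\<close> are uniformly Lipschitz, because \<open>\<Sum>(1 - (cmod a)\<^sup>2)\<close> over their zeros \<open>a\<close> is
  bounded and these zeros stay away, so that \<open>h = F / lim B n\<close> has a limit of modulus \<open>cmod F\<close>.

  For the rational approximation, a real polynomial in \<open>cos \<omega>\<close> approximates the fourth root of
  \<open>cmod F + e\<close>; it is the modulus of a polynomial in \<open>w\<close>, whose zeros in the disc are reflected to the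
  outside, and the product of the result with its conjugate has real coefficients.
\<close>

section \<open>Finite Blaschke products\<close>

text \<open>The disc automorphism with zero \<open>a\<close>, taken without the usual unimodular
  constant so that \<open>a = 0\<close> is covered by the same formula.\<close>

definition blaschke_factor :: "complex \<Rightarrow> complex \<Rightarrow> complex" where
  "blaschke_factor a w = (w - a) / (1 - cnj a * w)"

text \<open>Expanding both squares, the mixed terms cancel. The sign of the right-hand side settles
  how \<open>blaschke_factor\<close> compares with 1: it is nonnegative on the closed disc and zero
  on the circle.\<close>

lemma norm_blaschke_denominator:
  "(norm (1 - cnj a * w))\<^sup>2 - (norm (w - a))\<^sup>2 = (1 - (norm a)\<^sup>2) * (1 - (norm w)\<^sup>2)"
  unfolding cmod_power2 by (simp add: power2_eq_square algebra_simps)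

lemma norm_diff_le_blaschke_denominator:
  assumes "norm a < 1" "norm w \<le> 1"
  shows "norm (w - a) \<le> norm (1 - cnj a * w)"
proof -
  have "0 \<le> (1 - (norm a)\<^sup>2) * (1 - (norm w)\<^sup>2)"
    using assms by (simp add: abs_square_le_1 power_le_one)
  then have "(norm (w - a))\<^sup>2 \<le> (norm (1 - cnj a * w))\<^sup>2"
    using norm_blaschke_denominator[of a w] by linarith
  then show ?thesis
    by (simp add: abs_le_square_iff[symmetric])
qed

lemma blaschke_denominator_nonzero:
  assumes "norm a < 1" "norm w \<le> 1"
  shows "1 - cnj a * w \<noteq> 0"
proof
  assume "1 - cnj a * w = 0"
  then have "norm (cnj a * w) = 1"
    by (metis eq_iff_diff_eq_0 norm_one)
  moreover have "norm (cnj a * w) \<le> norm a"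
    using assms by (simp add: norm_mult mult_left_le)
  ultimately show False
    using assms by simp
qed

lemma norm_blaschke_factor_le_1:
  assumes "norm a < 1" "norm w \<le> 1"
  shows "norm (blaschke_factor a w) \<le> 1"
  using norm_diff_le_blaschke_denominator[OF assms] blaschke_denominator_nonzero[OF assms]
  by (simp add: blaschke_factor_def norm_divide)

lemma norm_blaschke_factor_eq_1:
  assumes "norm a < 1" "norm w = 1"
  shows "norm (blaschke_factor a w) = 1"
proof -
  have "(norm (1 - cnj a * w))\<^sup>2 = (norm (w - a))\<^sup>2"
    using norm_blaschke_denominator[of a w] assms by simp
  moreover have "w \<noteq> a"
    using assms by auto
  ultimately show ?thesis
    using assms by (simp add: blaschke_factor_def norm_divide)
qed

text \<open>By the identity for the denominator, 1 minus the left-hand side is \<open>P / N\<close>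
  with \<open>N \<le> 4\<close>; then 1 - x \<le> exp(-x) applies. In exponential form the bounds
  for the factors of a product add up in the exponent.\<close>

lemma norm_blaschke_factor_le_exp:
  assumes "norm a < 1" "norm w \<le> 1"
  shows "(norm (blaschke_factor a w))\<^sup>2 \<le> exp (- ((1 - (norm w)\<^sup>2) / 4 * (1 - (norm a)\<^sup>2)))"
proof -
  define N where "N = (norm (1 - cnj a * w))\<^sup>2"
  define P where "P = (1 - (norm a)\<^sup>2) * (1 - (norm w)\<^sup>2)"
  have N0: "N > 0"
    using blaschke_denominator_nonzero[OF assms] by (simp add: N_def)
  have P0: "P \<ge> 0"
    unfolding P_def using assms by (simp add: power_le_one)
  have "norm (1 - cnj a * w) \<le> 1 + norm (cnj a * w)"
    by (metis norm_one norm_triangle_ineq4)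
  also have "\<dots> \<le> 2"
    using assms mult_mono[of "norm a" 1 "norm w" 1] by (simp add: norm_mult)
  finally have "N \<le> 2\<^sup>2"
    unfolding N_def by (intro power_mono) auto
  then have "P / 4 \<le> P / N"
    using N0 P0 by (intro divide_left_mono) auto
  moreover have "(norm (blaschke_factor a w))\<^sup>2 = 1 - P / N"
    using norm_blaschke_denominator[of a w] N0
    unfolding blaschke_factor_def norm_divide power_divide N_def P_def
    by (simp add: field_simps)
  ultimately have "(norm (blaschke_factor a w))\<^sup>2 \<le> 1 + (- (P / 4))"
    by simp
  also have "\<dots> \<le> exp (- (P / 4))"
    by (rule exp_ge_add_one_self)
  finally show ?thesis
    by (simp add: P_def mult.commute)
qed

text \<open>Over the common denominator the numerator collapses to (1 - |a|^2)(w - w'), and each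
  denominator is at least the distance to \<open>a\<close>. The factor 1 - |a|^2 lets the constants
  of a product be controlled by its mass.\<close>

lemma blaschke_factor_lipschitz:
  assumes a: "norm a < 1" and w: "norm w \<le> 1" "norm w' \<le> 1"
    and d: "d > 0" "d \<le> norm (w - a)" "d \<le> norm (w' - a)"
  shows "norm (blaschke_factor a w - blaschke_factor a w') \<le> (1 - (norm a)\<^sup>2) / d\<^sup>2 * norm (w - w')"
proof -
  let ?n = "1 - cnj a * w" and ?n' = "1 - cnj a * w'"
  have nz: "?n \<noteq> 0" "?n' \<noteq> 0"
    using blaschke_denominator_nonzero a w by auto
  have ge: "d \<le> norm ?n" "d \<le> norm ?n'"
    using norm_diff_le_blaschke_denominator[OF a w(1)] norm_diff_le_blaschke_denominator[OF a w(2)] d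
    by auto
  have num: "(w - a) * ?n' - (w' - a) * ?n = of_real (1 - (norm a)\<^sup>2) * (w - w')"
    by (simp add: algebra_simps complex_norm_square[unfolded of_real_power])
  have "blaschke_factor a w - blaschke_factor a w' = of_real (1 - (norm a)\<^sup>2) * (w - w') / (?n * ?n')"
    unfolding blaschke_factor_def diff_frac_eq[OF nz] num ..
  then have "norm (blaschke_factor a w - blaschke_factor a w')
      = (1 - (norm a)\<^sup>2) * norm (w - w') / (norm ?n * norm ?n')"
    using a by (simp only: norm_divide norm_mult norm_of_real) (simp add: power_le_one)
  also have "\<dots> \<le> (1 - (norm a)\<^sup>2) * norm (w - w') / (d * d)"
    using a d ge by (intro divide_left_mono mult_mono mult_nonneg_nonneg mult_pos_pos) (auto simp: power_le_one intro: less_le_trans)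
  finally show ?thesis
    by (simp add: power2_eq_square)
qed

definition blaschke :: "complex multiset \<Rightarrow> complex \<Rightarrow> complex" where
  "blaschke A w = (\<Prod>a\<in>#A. blaschke_factor a w)"

text \<open>The quantity of the Blaschke condition, with 1 - |a|^2 in place of the comparable 1 -
  |a| because the factor estimates produce the former.\<close>

definition blaschke_mass :: "complex multiset \<Rightarrow> real" where
  "blaschke_mass A = (\<Sum>a\<in>#A. 1 - (norm a)\<^sup>2)"

lemma norm_blaschke_le_1:
  assumes "\<And>a. a \<in># A \<Longrightarrow> norm a < 1" "norm w \<le> 1"
  shows "norm (blaschke A w) \<le> 1"
  using assms
proof (induction A)
  case (add a A)
  then show ?case
    using mult_mono[OF norm_blaschke_factor_le_1[of a w], of "norm (blaschke A w)" 1]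
    by (simp add: blaschke_def norm_mult)
qed (simp add: blaschke_def)

lemma norm_blaschke_eq_1:
  assumes "\<And>a. a \<in># A \<Longrightarrow> norm a < 1" "norm w = 1"
  shows "norm (blaschke A w) = 1"
  using assms
  by (induction A) (simp_all add: blaschke_def norm_mult norm_blaschke_factor_eq_1)

lemma norm_blaschke_le_exp:
  assumes "\<And>a. a \<in># A \<Longrightarrow> norm a < 1" "norm w \<le> 1"
  shows "(norm (blaschke A w))\<^sup>2 \<le> exp (- ((1 - (norm w)\<^sup>2) / 4 * blaschke_mass A))"
  using assms
proof (induction A)
  case (add a A)
  then have "(norm (blaschke_factor a w))\<^sup>2 * (norm (blaschke A w))\<^sup>2
      \<le> exp (- ((1 - (norm w)\<^sup>2) / 4 * (1 - (norm a)\<^sup>2))) * exp (- ((1 - (norm w)\<^sup>2) / 4 * blaschke_mass A))"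
    by (intro mult_mono norm_blaschke_factor_le_exp) auto
  then show ?case
    by (simp add: blaschke_def blaschke_mass_def norm_mult power_mult_distrib exp_add[symmetric] ring_distribs)
qed (simp add: blaschke_def blaschke_mass_def)

text \<open>Telescoping over the factors: all have modulus at most 1, so the Lipschitz constants of
  the single factors simply add.\<close>

lemma blaschke_lipschitz:
  assumes "\<And>a. a \<in># A \<Longrightarrow> norm a < 1 \<and> d \<le> norm (w - a) \<and> d \<le> norm (w' - a)"
    and "norm w \<le> 1" "norm w' \<le> 1" "d > 0"
  shows "norm (blaschke A w - blaschke A w') \<le> blaschke_mass A / d\<^sup>2 * norm (w - w')"
  using assms
proof (induction A)
  case (add a A)
  let ?b = "blaschke_factor a"
  have "blaschke (add_mset a A) w - blaschke (add_mset a A) w'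
      = (?b w - ?b w') * blaschke A w + ?b w' * (blaschke A w - blaschke A w')"
    by (simp add: blaschke_def algebra_simps)
  then have "norm (blaschke (add_mset a A) w - blaschke (add_mset a A) w')
      \<le> norm (?b w - ?b w') * norm (blaschke A w) + norm (?b w') * norm (blaschke A w - blaschke A w')"
    by (metis norm_triangle_ineq norm_mult)
  also have "\<dots> \<le> norm (?b w - ?b w') * 1 + 1 * norm (blaschke A w - blaschke A w')"
    using add by (intro add_mono mult_mono norm_blaschke_le_1 norm_blaschke_factor_le_1) auto
  also have "\<dots> \<le> (1 - (norm a)\<^sup>2) / d\<^sup>2 * norm (w - w') + blaschke_mass A / d\<^sup>2 * norm (w - w')"
    using add blaschke_factor_lipschitz[of a w w' d] by auto
  also have "\<dots> = blaschke_mass (add_mset a A) / d\<^sup>2 * norm (w - w')"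
    by (simp add: blaschke_mass_def add_divide_distrib ring_distribs)
  finally show ?case .
qed (simp add: blaschke_def blaschke_mass_def)

text \<open>Each factor w - a with \<open>a\<close> in the open disc is traded for 1 - cnj a w,
  which has no zero in the closed disc; the quotient of the two is the Blaschke factor.\<close>

lemma poly_blaschke_factorization:
  fixes p :: "complex poly"
  assumes "p \<noteq> 0"
  obtains q A where "\<And>w. norm w < 1 \<Longrightarrow> poly q w \<noteq> 0"
    and "\<And>w. norm w \<le> 1 \<Longrightarrow> poly p w = poly q w * blaschke A w"
    and "\<And>a. a \<in># A \<Longrightarrow> norm a < 1 \<and> poly p a = 0"
proof -
  obtain M where M: "p = smult (lead_coeff p) (\<Prod>x\<in>#M. [:-x, 1:])"
    using alg_closed_imp_factorization[OF assms] by blast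
  define A where "A = filter_mset (\<lambda>a. norm a < 1) M"
  \<comment> \<open>Zeros on the circle are collected here and remain zeros of \<open>q\<close>,
    which is therefore claimed zero-free only in the open disc.\<close>
  define C where "C = filter_mset (\<lambda>a. \<not> norm a < 1) M"
  define q where "q = smult (lead_coeff p) ((\<Prod>x\<in>#C. [:-x, 1:]) * (\<Prod>x\<in>#A. [:1, - cnj x:]))"
  have "M = C + A"
    unfolding A_def C_def by (metis multiset_partition add.commute)
  then have p: "poly p w = lead_coeff p * ((\<Prod>x\<in>#C. w - x) * (\<Prod>x\<in>#A. w - x))" for w
    by (subst M) (simp add: poly_prod_mset image_mset.compositionality o_def)
  have q: "poly q w = lead_coeff p * ((\<Prod>x\<in>#C. w - x) * (\<Prod>x\<in>#A. 1 - cnj x * w))" for w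
    by (simp add: q_def poly_prod_mset image_mset.compositionality o_def mult.commute)
  have A: "norm a < 1" if "a \<in># A" for a
    using that by (simp add: A_def)
  have C: "norm a \<ge> 1" if "a \<in># C" for a
    using that by (simp add: C_def)
  show ?thesis
  proof
    show "poly q w \<noteq> 0" if "norm w < 1" for w
    proof -
      have "w \<notin># C"
        using C that by force
      moreover have "1 - cnj a * w \<noteq> 0" if "a \<in># A" for a
        using A[OF that] \<open>norm w < 1\<close> by (intro blaschke_denominator_nonzero) auto
      ultimately show ?thesis
        using assms by (force simp: q prod_mset_zero_iff)
    qed
    show "poly p w = poly q w * blaschke A w" if "norm w \<le> 1" for w
    proof -
      have "(\<Prod>x\<in>#A. 1 - cnj x * w) * blaschke A w = (\<Prod>x\<in>#A. w - x)"
        using A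
      proof (induction A)
        case (add a A)
        then show ?case
          using blaschke_denominator_nonzero[of a w] that
          by (simp add: blaschke_def blaschke_factor_def mult_ac)
      qed (simp add: blaschke_def)
      then show ?thesis
        unfolding p q by (simp add: mult.assoc)
    qed
    show "norm a < 1 \<and> poly p a = 0" if "a \<in># A" for a
      using A[OF that] that by (force simp: p prod_mset_zero_iff)
  qed
qed

section \<open>Outer functions in the disc algebra\<close>

text \<open>The dilation F(r w) is uniformly close to F by uniform continuity, and the Taylor series
  of F converges uniformly on the disc of radius \<open>r\<close> below 1.\<close>

lemma disc_algebra_poly_approx:
  assumes cont: "continuous_on (cball 0 1) F" and hol: "F holomorphic_on ball 0 1" and "e > 0"
  obtains p :: "complex poly" where "\<And>w. norm w \<le> 1 \<Longrightarrow> norm (poly p w - F w) < e"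
proof -
  have "uniformly_continuous_on (cball 0 1) F"
    using cont by (simp add: compact_uniformly_continuous)
  then obtain d where "d > 0"
    and d: "\<And>w w'. norm w \<le> 1 \<Longrightarrow> norm w' \<le> 1 \<Longrightarrow> dist w' w < d \<Longrightarrow> dist (F w') (F w) < e / 2"
    using \<open>e > 0\<close> unfolding uniformly_continuous_on_def
    by (metis dist_0_norm half_gt_zero mem_cball)
  define r where "r = 1 - min d 1 / 2"
  have r: "0 < r" "r < 1" "1 - r < d"
    using \<open>d > 0\<close> by (auto simp: r_def min_def)
  define c where "c = (\<lambda>n. (deriv ^^ n) F 0 / fact n)"
  have sums: "(\<lambda>n. c n * (w - 0) ^ n) sums F w" if "norm w < 1" for w
    using holomorphic_power_series[OF hol, of w] that unfolding c_def by simp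
  \<comment> \<open>A point strictly between \<open>r\<close> and 1 at which the series converges
    puts the radius of convergence strictly above \<open>r\<close>.\<close>
  have "norm (of_real ((1 + r) / 2) :: complex) < 1"
    unfolding norm_of_real using r by simp
  from sums_summable[OF sums[OF this]]
  have "summable (\<lambda>n. c n * of_real ((1 + r) / 2) ^ n)"
    by simp
  then have "ereal (norm (of_real ((1 + r) / 2) :: complex)) \<le> conv_radius c"
    by (rule conv_radius_geI)
  moreover have "ereal r < ereal (norm (of_real ((1 + r) / 2) :: complex))"
    unfolding norm_of_real using r by simp
  ultimately have "ereal r < conv_radius c"
    by order
  then have "uniform_limit (cball 0 r) (\<lambda>n x. \<Sum>i<n. c i * (x - 0) ^ i)
      (\<lambda>x. suminf (\<lambda>i. c i * (x - 0) ^ i)) sequentially"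
    by (rule powser_uniform_limit)
  then have "\<forall>\<^sub>F n in sequentially. \<forall>x\<in>cball 0 r.
      dist (\<Sum>i<n. c i * (x - 0) ^ i) (suminf (\<lambda>i. c i * (x - 0) ^ i)) < e / 2"
    using \<open>e > 0\<close> unfolding uniform_limit_iff by (meson half_gt_zero)
  then obtain n where n: "\<And>x. norm x \<le> r \<Longrightarrow>
      dist (\<Sum>i<n. c i * (x - 0) ^ i) (suminf (\<lambda>i. c i * (x - 0) ^ i)) < e / 2"
    unfolding eventually_sequentially by (meson mem_cball_0 order_refl)
  define p where "p = (\<Sum>i<n. monom (c i * of_real r ^ i) i)"
  have p: "poly p w = (\<Sum>i<n. c i * (of_real r * w - 0) ^ i)" for w
    by (simp add: p_def poly_sum poly_monom power_mult_distrib mult_ac)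
  show ?thesis
  proof
    fix w :: complex assume w: "norm w \<le> 1"
    have rw: "norm (of_real r * w) \<le> r"
      using w r by (simp add: norm_mult mult_left_le)
    have "dist (poly p w) (F (of_real r * w)) < e / 2"
      using n[OF rw] sums_unique[OF sums[of "of_real r * w"]] rw r unfolding p by simp
    moreover have "dist (of_real r * w) w = (1 - r) * norm w"
    proof -
      have "dist (of_real r * w) w = norm (of_real (r - 1) * w)"
        unfolding dist_norm by (simp add: algebra_simps)
      then show ?thesis
        using r unfolding norm_mult norm_of_real by simp
    qed
    then have "dist (of_real r * w) w < d"
      using r w mult_left_le[of "norm w" "1 - r"] by linarith
    then have "dist (F (of_real r * w)) (F w) < e / 2"
      using w rw r by (intro d) auto
    ultimately have "dist (poly p w) (F w) < e"
      using dist_triangle[of "poly p w" "F w" "F (of_real r * w)"] by simp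
    then show "norm (poly p w - F w) < e"
      by (simp add: dist_norm)
  qed
qed

text \<open>Powers of the peaking function \<open>(1 + w * cnj \<zeta>) / 2\<close> play the role of the Poisson kernel.\<close>

lemma tendsto_zero_at_boundary:
  fixes f :: "nat \<Rightarrow> complex \<Rightarrow> complex"
  assumes cont: "\<And>n. continuous_on (cball 0 1) (f n)" and hol: "\<And>n. f n holomorphic_on ball 0 1"
    and bdd: "\<And>n w. norm w = 1 \<Longrightarrow> norm (f n w) \<le> M"
    and lim: "\<And>w. norm w < 1 \<Longrightarrow> (\<lambda>n. f n w) \<longlonglongrightarrow> g w"
    and \<zeta>: "norm \<zeta> = 1"
    and small: "\<And>e. e > 0 \<Longrightarrow> \<exists>d>0. \<forall>\<^sub>F n in sequentially. \<forall>w. norm w = 1 \<longrightarrow> dist w \<zeta> < d \<longrightarrow> norm (f n w) \<le> e"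
  shows "(g \<longlongrightarrow> 0) (at \<zeta> within ball 0 1)"
proof -
  define \<psi> where "\<psi> w = (1 + w * cnj \<zeta>) / 2" for w
  \<comment> \<open>From the parallelogram law for \<open>\<zeta>\<close> and \<open>w\<close>: on
    the circle \<open>\<psi>\<close> has modulus 1 only at \<open>\<zeta>\<close>, with an explicit
    drop elsewhere.\<close>
  have norm_\<psi>: "(norm (\<psi> w))\<^sup>2 = 1 - (dist w \<zeta>)\<^sup>2 / 4" if "norm w = 1" for w
  proof -
    have \<zeta>1: "\<zeta> * cnj \<zeta> = 1"
      using \<zeta> by (simp add: complex_norm_square[symmetric])
    have "(\<zeta> + w) * cnj \<zeta> = 1 + w * cnj \<zeta>"
      using \<zeta>1 by (simp add: ring_distribs)
    then have "norm (1 + w * cnj \<zeta>) = norm (\<zeta> + w)"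
      using \<zeta> by (metis complex_mod_cnj mult.right_neutral norm_mult)
    then have "(norm (\<psi> w))\<^sup>2 = (norm (\<zeta> + w))\<^sup>2 / 4"
      by (simp add: \<psi>_def norm_divide power_divide)
    moreover have "(norm (\<zeta> + w))\<^sup>2 + (norm (w - \<zeta>))\<^sup>2 = 2 * (norm \<zeta>)\<^sup>2 + 2 * (norm w)\<^sup>2"
      unfolding cmod_power2 by (simp add: power2_eq_square algebra_simps)
    ultimately show ?thesis
      using \<zeta> that by (simp add: dist_norm)
  qed
  have bound: "\<exists>k. \<forall>w. norm w < 1 \<longrightarrow> norm (g w) * norm (\<psi> w) ^ k \<le> e" if e: "e > 0" for e
  proof -
    obtain d where "d > 0"
      and ev: "\<forall>\<^sub>F n in sequentially. \<forall>w. norm w = 1 \<longrightarrow> dist w \<zeta> < d \<longrightarrow> norm (f n w) \<le> e"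
      using small[OF e] by blast
    \<comment> \<open>Bounds |\<psi>| on the circle away from \<open>\<zeta>\<close>; the maximum
      with 0 covers \<open>d > 2\<close>, where no point is that far away.\<close>
    define \<rho> where "\<rho> = sqrt (max 0 (1 - d\<^sup>2 / 4))"
    have \<rho>: "0 \<le> \<rho>" "\<rho> < 1"
      using \<open>d > 0\<close> by (auto simp: \<rho>_def)
    have \<psi>_far: "norm (\<psi> w) \<le> \<rho>" if "norm w = 1" "d \<le> dist w \<zeta>" for w
    proof -
      have "d\<^sup>2 \<le> (dist w \<zeta>)\<^sup>2"
        using that \<open>d > 0\<close> by (intro power_mono) auto
      then have "(norm (\<psi> w))\<^sup>2 \<le> max 0 (1 - d\<^sup>2 / 4)"
        unfolding norm_\<psi>[OF that(1)] by simp
      then show ?thesis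
        unfolding \<rho>_def by (rule real_le_rsqrt)
    qed
    have \<psi>_le: "norm (\<psi> w) \<le> 1" if "norm w = 1" for w
      using norm_\<psi>[OF that] by (simp flip: abs_square_le_1[of "norm (\<psi> w)", simplified])
    have M: "0 \<le> M"
      using bdd[OF \<zeta>, of 0] norm_ge_zero order_trans by blast
    have "(\<lambda>k. M * \<rho> ^ k) \<longlonglongrightarrow> M * 0"
      using \<rho> by (intro tendsto_intros LIMSEQ_power_zero) auto
    then have "\<forall>\<^sub>F k in sequentially. M * \<rho> ^ k < e"
      using e by (intro order_tendstoD) auto
    then obtain k where k: "M * \<rho> ^ k < e"
      by (auto simp: eventually_sequentially)
    have "norm (g w) * norm (\<psi> w) ^ k \<le> e" if w: "norm w < 1" for w
    proof (rule tendsto_upperbound)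
      show "(\<lambda>n. norm (f n w) * norm (\<psi> w) ^ k) \<longlonglongrightarrow> norm (g w) * norm (\<psi> w) ^ k"
        using lim[OF w] by (intro tendsto_intros)
      show "\<forall>\<^sub>F n in sequentially. norm (f n w) * norm (\<psi> w) ^ k \<le> e"
        using ev
      proof eventually_elim
        case (elim n)
        \<comment> \<open>The exponent \<open>k\<close> is independent of \<open>n\<close>. On the
          frontier \<open>f n\<close> is small close to \<open>\<zeta>\<close>, and elsewhere the
          power of \<open>\<psi>\<close> beats the bound \<open>M\<close>; the maximum principle
          carries the estimate inside.\<close>
        have "norm (f n w * \<psi> w ^ k) \<le> e"
        proof (rule maximum_modulus_frontier[of "\<lambda>w. f n w * \<psi> w ^ k" "cball 0 1"])
          show "(\<lambda>w. f n w * \<psi> w ^ k) holomorphic_on interior (cball 0 1)"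
            unfolding \<psi>_def using hol[of n] by (auto intro!: holomorphic_intros)
          show "continuous_on (closure (cball 0 1)) (\<lambda>w. f n w * \<psi> w ^ k)"
            unfolding \<psi>_def using cont[of n] by (auto intro!: continuous_intros)
          show "norm (f n z * \<psi> z ^ k) \<le> e" if "z \<in> frontier (cball 0 1)" for z
          proof (cases "dist z \<zeta> < d")
            case True
            then have "norm (f n z) * norm (\<psi> z) ^ k \<le> e * 1"
              using that elim e \<psi>_le[of z] by (intro mult_mono) (auto simp: power_le_one)
            then show ?thesis
              by (simp add: norm_mult norm_power)
          next
            case False
            then have "norm (f n z) * norm (\<psi> z) ^ k \<le> M * \<rho> ^ k"
              using that bdd[of z n] \<psi>_far[of z] M by (intro mult_mono power_mono) auto
            then show ?thesis
              using k by (simp add: norm_mult norm_power)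
          qed
        qed (use w in auto)
        then show ?case
          by (simp add: norm_mult norm_power)
      qed
    qed auto
    then show ?thesis
      by blast
  qed
  show ?thesis
  proof (rule tendstoI)
    fix e :: real assume e: "e > 0"
    obtain k where k: "\<And>w. norm w < 1 \<Longrightarrow> norm (g w) * norm (\<psi> w) ^ k \<le> e / 4"
      using bound[of "e / 4"] e by auto
    \<comment> \<open>With \<open>k\<close> fixed, |\<psi>|^k exceeds 1/2 near
      \<open>\<zeta>\<close>, so removing it costs only a factor 2.\<close>
    have "\<psi> \<zeta> = 1"
      using \<zeta> by (simp add: \<psi>_def complex_norm_square[symmetric])
    moreover have "((\<lambda>w. norm (\<psi> w) ^ k) \<longlongrightarrow> norm (\<psi> \<zeta>) ^ k) (at \<zeta> within ball 0 1)"
      unfolding \<psi>_def by (intro tendsto_intros) auto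
    ultimately have "\<forall>\<^sub>F w in at \<zeta> within ball 0 1. norm (\<psi> w) ^ k > 1 / 2"
      by (intro order_tendstoD) auto
    moreover have "\<forall>\<^sub>F w in at \<zeta> within ball 0 1. w \<in> ball 0 1"
      by (simp add: eventually_at_filter)
    ultimately show "\<forall>\<^sub>F w in at \<zeta> within ball 0 1. dist (g w) 0 < e"
    proof eventually_elim
      case (elim w)
      have "norm (g w) * (1 / 2) \<le> norm (g w) * norm (\<psi> w) ^ k"
        using elim by (intro mult_left_mono) auto
      also have "\<dots> \<le> e / 4"
        using elim by (intro k) auto
      finally show ?case
        using e by simp
    qed
  qed
qed

text \<open>\<open>h\<close> stands in for the outer factor through two properties: no zeros in the
  disc, and boundary modulus |F|. The limits are unrestricted rather than radial and exist at every
  boundary point, as continuity up to the circle requires.\<close>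

lemma disc_algebra_outer:
  assumes cont: "continuous_on (cball 0 1) F" and hol: "F holomorphic_on ball 0 1"
    and z0: "norm z0 < 1" "F z0 \<noteq> 0"
  obtains h where "h holomorphic_on ball 0 1" "\<And>w. norm w < 1 \<Longrightarrow> h w \<noteq> 0"
    "\<And>\<zeta>. norm \<zeta> = 1 \<Longrightarrow> \<exists>l. (h \<longlongrightarrow> l) (at \<zeta> within ball 0 1) \<and> norm l = norm (F \<zeta>)"
proof -
  define c where "c = norm (F z0)"
  have c: "c > 0"
    using z0 by (simp add: c_def)
  \<comment> \<open>Tends to 0 and never exceeds c/2, so that every approximant keeps modulus at
    least c/2 at \<open>z0\<close>.\<close>
  define err where "err n = c / 2 / real (Suc n)" for n :: nat
  have err: "err n > 0" "err n \<le> c / 2" for n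
    using c by (auto simp: err_def field_simps)
  have err0: "err \<longlonglongrightarrow> 0"
    unfolding err_def by real_asymp
  have "\<exists>p :: complex poly. \<forall>w. norm w \<le> 1 \<longrightarrow> norm (poly p w - F w) < err n" for n
    using disc_algebra_poly_approx[OF cont hol err(1)[of n]] by metis
  then obtain p :: "nat \<Rightarrow> complex poly"
    where p: "\<And>n w. norm w \<le> 1 \<Longrightarrow> norm (poly (p n) w - F w) < err n"
    by metis
  have pz0: "norm (poly (p n) z0) \<ge> c / 2" for n
    using p[of z0 n] err(2)[of n] z0 norm_triangle_ineq2[of "F z0" "poly (p n) z0"]
    by (simp add: c_def norm_minus_commute)
  then have pnz: "p n \<noteq> 0" for n
    using c by (metis half_gt_zero norm_zero not_le poly_0)
  have "\<exists>q A. (\<forall>w. norm w < 1 \<longrightarrow> poly q w \<noteq> 0) \<and>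
      (\<forall>w. norm w \<le> 1 \<longrightarrow> poly (p n) w = poly q w * blaschke A w) \<and>
      (\<forall>a. a \<in># A \<longrightarrow> norm a < 1 \<and> poly (p n) a = 0)" for n
    by (rule poly_blaschke_factorization[OF pnz[of n]]) blast
  then obtain q A where q: "\<And>n w. norm w < 1 \<Longrightarrow> poly (q n) w \<noteq> 0"
    and pq: "\<And>n w. norm w \<le> 1 \<Longrightarrow> poly (p n) w = poly (q n) w * blaschke (A n) w"
    and A: "\<And>n a. a \<in># A n \<Longrightarrow> norm a < 1" "\<And>n a. a \<in># A n \<Longrightarrow> poly (p n) a = 0"
    by metis
  have "compact (F ` cball 0 1)"
    using cont by (intro compact_continuous_image) auto
  then obtain M0 where M0: "\<And>w. norm w \<le> 1 \<Longrightarrow> norm (F w) \<le> M0"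
    by (metis bounded_iff compact_imp_bounded image_eqI mem_cball_0)
  define M where "M = M0 + c"
  have "0 \<le> M0"
    using order_trans[OF norm_ge_zero M0[of 0]] by simp
  then have M: "0 < M"
    using c by (simp add: M_def)
  have pM: "norm (poly (p n) w) \<le> M" if "norm w \<le> 1" for n w
    using norm_triangle_sub[of "poly (p n) w" "F w"] p[OF that, of n] err(2)[of n] M0[OF that] c
    by (simp add: M_def)
  have qp: "norm (poly (q n) w) = norm (poly (p n) w)" if "norm w = 1" for n w
    using pq[of w n] norm_blaschke_eq_1[of "A n" w] A that by (simp add: norm_mult)
  \<comment> \<open>\<open>q n\<close> and \<open>p n\<close> have the same modulus on the circle,
    so the maximum principle transfers the bound to the disc.\<close>
  have qM: "norm (poly (q n) w) \<le> M" if "norm w \<le> 1" for n w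
  proof (rule maximum_modulus_frontier[of "poly (q n)" "cball 0 1"])
    show "norm (poly (q n) z) \<le> M" if "z \<in> frontier (cball 0 1)" for z
      using that qp[of z] pM[of z] by simp
  qed (use that in \<open>auto intro!: holomorphic_intros continuous_intros\<close>)
  \<comment> \<open>Obtained by solving the exponential estimate at \<open>z0\<close> for the mass,
    given that the Blaschke product has modulus at least c/(2M) there.\<close>
  define K where "K = 4 / (1 - (norm z0)\<^sup>2) * ln ((2 * M / c)\<^sup>2)"
  have mass: "blaschke_mass (A n) \<le> K" for n
  proof -
    have "c / 2 \<le> norm (poly (q n) z0) * norm (blaschke (A n) z0)"
      using pz0[of n] pq[of z0 n] z0 by (simp add: norm_mult)
    also have "\<dots> \<le> M * norm (blaschke (A n) z0)"
      using qM[of z0 n] z0 by (intro mult_right_mono) auto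
    finally have "c / (2 * M) \<le> norm (blaschke (A n) z0)"
      using M by (simp add: field_simps)
    then have "(c / (2 * M))\<^sup>2 \<le> (norm (blaschke (A n) z0))\<^sup>2"
      using c M by (intro power_mono) auto
    also have "\<dots> \<le> exp (- ((1 - (norm z0)\<^sup>2) / 4 * blaschke_mass (A n)))"
      using z0 A by (intro norm_blaschke_le_exp) auto
    finally have "(c / (2 * M))\<^sup>2 \<le> exp (- ((1 - (norm z0)\<^sup>2) / 4 * blaschke_mass (A n)))" .
    from ln_mono[OF this] have "ln ((c / (2 * M))\<^sup>2) \<le> - ((1 - (norm z0)\<^sup>2) / 4 * blaschke_mass (A n))"
      using c M by simp
    moreover have "ln ((2 * M / c)\<^sup>2) = - ln ((c / (2 * M))\<^sup>2)"
      using c M by (simp add: ln_div ln_mult ln_realpow)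
    moreover have "1 - (norm z0)\<^sup>2 > 0"
      using z0 by (simp add: abs_square_less_1)
    ultimately show ?thesis
      unfolding K_def by (simp add: field_simps)
  qed
  obtain h r where h: "h holomorphic_on ball 0 1" and r: "strict_mono (r :: nat \<Rightarrow> nat)"
    and lim: "\<And>w. w \<in> ball 0 1 \<Longrightarrow> (\<lambda>n. poly (q (r n)) w) \<longlonglongrightarrow> h w"
    and ul: "\<And>K. compact K \<Longrightarrow> K \<subseteq> ball 0 1 \<Longrightarrow>
          uniform_limit K ((\<lambda>n. poly (q n)) \<circ> r) h sequentially"
  proof (rule Montel[of "ball 0 1" "range (\<lambda>n. poly (q n))" "\<lambda>n. poly (q n)"])
    show "\<exists>B. \<forall>h\<in>range (\<lambda>n. poly (q n)). \<forall>z\<in>K. norm (h z) \<le> B"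
      if "compact K" "K \<subseteq> ball 0 1" for K
      using that qM by (intro exI[of _ M]) (auto simp: subset_iff less_imp_le)
  qed (auto intro!: holomorphic_intros)
  have errr: "(\<lambda>n. err (r n)) \<longlonglongrightarrow> 0"
    using LIMSEQ_subseq_LIMSEQ[OF err0 r] by (simp add: o_def)
  have plim: "(\<lambda>n. poly (p (r n)) w) \<longlonglongrightarrow> F w" if "norm w \<le> 1" for w
  proof -
    have "(\<lambda>n. poly (p (r n)) w - F w) \<longlonglongrightarrow> 0"
      using p[OF that] by (intro Lim_null_comparison[OF _ errr] always_eventually allI less_imp_le)
    then show ?thesis
      by (simp add: LIM_zero_iff)
  qed
  \<comment> \<open>Dividing by a Blaschke product cannot decrease the modulus. Hence the limit is
    not the zero function, the alternative left open by Hurwitz.\<close>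
  have "norm (poly (q n) z0) \<ge> c / 2" for n
  proof -
    have "c / 2 \<le> norm (poly (q n) z0) * norm (blaschke (A n) z0)"
      using pz0[of n] pq[of z0 n] z0 by (simp add: norm_mult)
    also have "\<dots> \<le> norm (poly (q n) z0) * 1"
      using A z0 by (intro mult_left_mono norm_blaschke_le_1) auto
    finally show ?thesis
      by simp
  qed
  then have "norm (h z0) \<ge> c / 2"
    using z0 by (intro tendsto_lowerbound[OF tendsto_norm[OF lim[of z0]]]) auto
  then have hz0: "h z0 \<noteq> 0"
    using c by auto
  have hnz: "h w \<noteq> 0" if w: "norm w < 1" for w
  proof (cases "h constant_on ball 0 1")
    case True
    then have "h w = h z0"
      using w z0 by (auto simp: constant_on_def)
    then show ?thesis
      using hz0 by simp
  next
    case False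
    show ?thesis
      by (rule Hurwitz_no_zeros[OF _ _ _ h ul False])
        (use w q in \<open>auto intro!: holomorphic_intros\<close>)
  qed
  show ?thesis
  proof
    fix \<zeta> :: complex assume \<zeta>: "norm \<zeta> = 1"
    have Fcont: "\<exists>d>0. \<forall>w. norm w \<le> 1 \<longrightarrow> dist w \<zeta> < d \<longrightarrow> dist (F w) (F \<zeta>) < e" if "e > 0" for e
    proof -
      have "\<zeta> \<in> cball 0 1"
        using \<zeta> by simp
      then show ?thesis
        using cont that unfolding continuous_on_iff by (metis mem_cball_0)
    qed
    show "\<exists>l. (h \<longlongrightarrow> l) (at \<zeta> within ball 0 1) \<and> norm l = norm (F \<zeta>)"
    proof (cases "F \<zeta> = 0")
      case True
      \<comment> \<open>On the circle \<open>q (r n)\<close> has the modulus of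
        \<open>p (r n)\<close>, hence nearly that of \<open>F\<close>, which is small near its zero
        \<open>\<zeta>\<close>.\<close>
      have "(h \<longlongrightarrow> 0) (at \<zeta> within ball 0 1)"
      proof (rule tendsto_zero_at_boundary[where f = "\<lambda>n. poly (q (r n))" and M = M])
        fix e :: real assume e: "e > 0"
        obtain d where d: "d > 0" "\<And>w. norm w \<le> 1 \<Longrightarrow> dist w \<zeta> < d \<Longrightarrow> dist (F w) (F \<zeta>) < e / 2"
          using Fcont[of "e / 2"] e by auto
        have "\<forall>\<^sub>F n in sequentially. err (r n) < e / 2"
          using errr e by (intro order_tendstoD) auto
        then have "\<forall>\<^sub>F n in sequentially. \<forall>w. norm w = 1 \<longrightarrow> dist w \<zeta> < d \<longrightarrow> norm (poly (q (r n)) w) \<le> e"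
        proof eventually_elim
          case (elim n)
          show ?case
          proof (intro allI impI)
            fix w :: complex assume w: "norm w = 1" "dist w \<zeta> < d"
            show "norm (poly (q (r n)) w) \<le> e"
              using qp[OF w(1), of "r n"] norm_triangle_sub[of "poly (p (r n)) w" "F w"]
                p[of w "r n"] d(2)[of w] w elim True by simp
          qed
        qed
        then show "\<exists>d>0. \<forall>\<^sub>F n in sequentially. \<forall>w. norm w = 1 \<longrightarrow> dist w \<zeta> < d \<longrightarrow> norm (poly (q (r n)) w) \<le> e"
          using d(1) by blast
      qed (use \<zeta> qM lim in \<open>auto intro!: holomorphic_intros continuous_intros\<close>)
      then show ?thesis
        using True by auto
    next
      case False
      obtain d0 where d0: "d0 > 0" "\<And>w. norm w \<le> 1 \<Longrightarrow> dist w \<zeta> < d0 \<Longrightarrow> dist (F w) (F \<zeta>) < norm (F \<zeta>) / 2"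
        using Fcont[of "norm (F \<zeta>) / 2"] False by auto
      \<comment> \<open>Half the radius: Blaschke zeros at distance at least 2d from
        \<open>\<zeta>\<close> stay at distance at least d from every point within d of
        \<open>\<zeta>\<close>.\<close>
      define d where "d = d0 / 2"
      have d: "d > 0" "d0 = 2 * d"
        using d0 by (auto simp: d_def)
      have ev: "\<forall>\<^sub>F n in sequentially. err (r n) < norm (F \<zeta>) / 2"
        using errr False by (intro order_tendstoD) auto
      define b where "b n = blaschke (A (r n))" for n
      have lip: "norm (b n w - b n \<zeta>) \<le> K / d\<^sup>2 * norm (w - \<zeta>)"
        if n: "err (r n) < norm (F \<zeta>) / 2" and w: "norm w < 1" "dist w \<zeta> < d" for n w
      proof -
        have "norm (b n w - b n \<zeta>) \<le> blaschke_mass (A (r n)) / d\<^sup>2 * norm (w - \<zeta>)"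
          unfolding b_def
        proof (rule blaschke_lipschitz)
          fix a assume a: "a \<in># A (r n)"
          \<comment> \<open>\<open>a\<close> is a zero of the approximant, so |F(a)| is below half
            of |F(\<zeta>)|; close to \<open>\<zeta>\<close> the values of \<open>F\<close> are too
            near F(\<zeta>) for that.\<close>
          have "dist a \<zeta> \<ge> d0"
          proof (rule ccontr)
            assume "\<not> d0 \<le> dist a \<zeta>"
            then have "dist (F a) (F \<zeta>) < norm (F \<zeta>) / 2"
              using A(1)[OF a] by (intro d0) auto
            moreover have "norm (F a) < norm (F \<zeta>) / 2"
              using p[of a "r n"] A[OF a] n by simp
            ultimately show False
              using norm_triangle_ineq2[of "F \<zeta>" "F a"] by (simp add: dist_norm norm_minus_commute)
          qed
          then show "norm a < 1 \<and> d \<le> norm (w - a) \<and> d \<le> norm (\<zeta> - a)"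
            using A(1)[OF a] d w dist_triangle[of a \<zeta> w]
            by (simp add: dist_norm norm_minus_commute)
        qed (use w \<zeta> d in auto)
        also have "\<dots> \<le> K / d\<^sup>2 * norm (w - \<zeta>)"
          using mass[of "r n"] by (intro mult_right_mono divide_right_mono) auto
        finally show ?thesis .
      qed
      \<comment> \<open>The values at \<open>\<zeta>\<close> are unimodular, so a subsequence
        \<open>s\<close> of them converges. It may depend on \<open>\<zeta>\<close>, whereas
        \<open>h\<close> is fixed by the earlier choice of \<open>r\<close>.\<close>
      have "\<forall>n. b n \<zeta> \<in> sphere 0 1"
        using \<zeta> A by (auto simp: b_def norm_blaschke_eq_1)
      then obtain \<beta> s where \<beta>: "\<beta> \<in> sphere 0 1" and s: "strict_mono (s :: nat \<Rightarrow> nat)"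
        and b\<beta>: "((\<lambda>n. b n \<zeta>) \<circ> s) \<longlonglongrightarrow> \<beta>"
        using compact_sphere[of "0 :: complex" 1] unfolding compact_def by metis
      have FhB: "norm (F w / h w - \<beta>) \<le> K / d\<^sup>2 * norm (w - \<zeta>)" if w: "norm w < 1" "dist w \<zeta> < d" for w
      proof (rule tendsto_upperbound)
        \<comment> \<open>The Blaschke products are the quotients p/q, so they converge to F/h
          inside the disc, and the uniform Lipschitz bound survives the limit.\<close>
        have "b n w = poly (p (r n)) w / poly (q (r n)) w" for n
          using pq[of w "r n"] q[of w "r n"] w by (simp add: b_def)
        moreover have "(\<lambda>n. poly (p (r n)) w / poly (q (r n)) w) \<longlonglongrightarrow> F w / h w"
          using w hnz by (intro tendsto_intros plim lim) auto
        ultimately have "(\<lambda>n. b n w) \<longlonglongrightarrow> F w / h w"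
          by simp
        from LIMSEQ_subseq_LIMSEQ[OF this s]
        show "(\<lambda>n. norm (b (s n) w - b (s n) \<zeta>)) \<longlonglongrightarrow> norm (F w / h w - \<beta>)"
          using b\<beta> by (intro tendsto_intros) (auto simp: o_def)
        have "\<forall>\<^sub>F n in sequentially. err (r (s n)) < norm (F \<zeta>) / 2"
          using eventually_subseq[OF s ev] .
        then show "\<forall>\<^sub>F n in sequentially. norm (b (s n) w - b (s n) \<zeta>) \<le> K / d\<^sup>2 * norm (w - \<zeta>)"
          by eventually_elim (rule lip[OF _ w])
      qed auto
      have "((\<lambda>w. F w / h w - \<beta>) \<longlongrightarrow> 0) (at \<zeta> within ball 0 1)"
      proof (rule Lim_null_comparison)
        have "((\<lambda>w. K / d\<^sup>2 * norm (w - \<zeta>)) \<longlongrightarrow> K / d\<^sup>2 * norm (\<zeta> - \<zeta>)) (at \<zeta> within ball 0 1)"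
          by (intro tendsto_intros)
        then show "((\<lambda>w. K / d\<^sup>2 * norm (w - \<zeta>)) \<longlongrightarrow> 0) (at \<zeta> within ball 0 1)"
          by simp
        show "\<forall>\<^sub>F w in at \<zeta> within ball 0 1. norm (F w / h w - \<beta>) \<le> K / d\<^sup>2 * norm (w - \<zeta>)"
          using d(1) FhB unfolding eventually_at by auto
      qed
      then have "((\<lambda>w. F w / h w) \<longlongrightarrow> \<beta>) (at \<zeta> within ball 0 1)"
        by (simp add: LIM_zero_iff)
      moreover have "(F \<longlongrightarrow> F \<zeta>) (at \<zeta> within ball 0 1)"
        using cont \<zeta> tendsto_within_subset[of F _ \<zeta> "cball 0 1" "ball 0 1"]
        unfolding continuous_on_def by (auto simp: ball_subset_cball)
      \<comment> \<open>Recovers \<open>h\<close>: as \<open>F\<close> has no zero near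
        \<open>\<zeta>\<close>, the double quotient is genuine there.\<close>
      ultimately have "((\<lambda>w. F w / (F w / h w)) \<longlongrightarrow> F \<zeta> / \<beta>) (at \<zeta> within ball 0 1)"
        using \<beta> by (intro tendsto_divide) auto
      moreover have "\<forall>\<^sub>F w in at \<zeta> within ball 0 1. F w / (F w / h w) = h w"
      proof -
        have "F w \<noteq> 0" if "norm w < 1" "dist w \<zeta> < d0" for w
          using d0(2)[of w] that False by auto
        then show ?thesis
          using d0(1) hnz unfolding eventually_at by auto
      qed
      ultimately have "(h \<longlongrightarrow> F \<zeta> / \<beta>) (at \<zeta> within ball 0 1)"
        by (simp cong: tendsto_cong)
      then show ?thesis
        using \<beta> by (auto simp: norm_divide)
    qed
  qed (use h hnz in auto)
qed

section \<open>Minimum phase spectral factors\<close>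

lemma stable_causal_disc:
  assumes "stable_causal G"
  obtains F where "continuous_on (cball 0 1) F" "F holomorphic_on ball 0 1"
    "\<And>w. norm w \<le> 1 \<Longrightarrow> F (cnj w) = cnj (F w)"
    "\<And>w. norm w \<le> 1 \<Longrightarrow> w \<noteq> 0 \<Longrightarrow> F w = G (1 / w)"
proof -
  obtain g :: "nat \<Rightarrow> real" where g: "\<And>z. norm z > 1 \<Longrightarrow> (\<lambda>k. of_real (g k) / z ^ k) sums G z"
    and contG: "continuous_on {z. norm z \<ge> 1} G"
    using assms unfolding stable_causal_def causal_def by blast
  \<comment> \<open>w = 0 corresponds to infinity, where the filter has the value
    \<open>g 0\<close>; the expression \<open>G (1 / 0)\<close> would be \<open>G 0\<close>, which
    carries no information.\<close>
  define F where "F w = (if w = 0 then of_real (g 0) else G (1 / w))" for w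
  have sums: "(\<lambda>k. of_real (g k) * (w - 0) ^ k) sums F w" if "w \<in> ball 0 1" for w
  proof (cases "w = 0")
    case True
    then show ?thesis
      using powser_sums_zero[of "\<lambda>k. of_real (g k)"] by (simp add: F_def)
  next
    case False
    then show ?thesis
      using g[of "1 / w"] that by (simp add: F_def norm_divide field_simps power_divide)
  qed
  have hol: "F holomorphic_on ball 0 1"
    by (rule power_series_holomorphic[OF sums])
  \<comment> \<open>Glued from two relatively open pieces: the open disc, where the power series
    gives holomorphy, and the punctured closed disc, where \<open>G\<close> is continuous.\<close>
  have "continuous_on (ball 0 1 \<union> (cball 0 1 - {0})) F"
  proof (rule continuous_on_Un_local_open)
    have eq: "ball 0 1 \<union> (cball 0 1 - {0}) = cball (0 :: complex) 1"
      by auto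
    show "openin (top_of_set (ball 0 1 \<union> (cball 0 1 - {0}))) (ball (0 :: complex) 1)"
      unfolding eq by (intro open_subset) auto
    show "openin (top_of_set (ball 0 1 \<union> (cball 0 1 - {0}))) (cball (0 :: complex) 1 - {0})"
      unfolding eq by (simp add: openin_delete)
    show "continuous_on (ball 0 1) F"
      by (rule holomorphic_on_imp_continuous_on[OF hol])
    have "continuous_on (cball 0 1 - {0}) (\<lambda>w. G (1 / w))"
      by (rule continuous_on_compose2[OF contG]) (auto intro!: continuous_intros simp: norm_divide divide_simps)
    then show "continuous_on (cball 0 1 - {0}) F"
      by (rule continuous_on_eq) (auto simp: F_def)
  qed
  moreover have "ball 0 1 \<union> (cball 0 1 - {0}) = cball (0 :: complex) 1"
    by auto
  ultimately have cont: "continuous_on (cball 0 1) F"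
    by simp
  \<comment> \<open>Real coefficients give the symmetry in the open disc; continuity extends it to
    the circle.\<close>
  have "F (cnj w) - cnj (F w) = 0" if "norm w \<le> 1" for w
  proof (rule continuous_constant_on_closure[of "ball 0 1" "\<lambda>w. F (cnj w) - cnj (F w)"])
    show "continuous_on (closure (ball 0 1)) (\<lambda>w. F (cnj w) - cnj (F w))"
      using cont by (auto intro!: continuous_intros continuous_on_compose2[OF cont])
    show "F (cnj w) - cnj (F w) = 0" if w: "w \<in> ball 0 1" for w
    proof -
      have "(\<lambda>k. cnj (of_real (g k) * (w - 0) ^ k)) sums cnj (F w)"
        using sums[OF w] by (simp only: sums_cnj)
      moreover have "(\<lambda>k. of_real (g k) * (cnj w - 0) ^ k) sums F (cnj w)"
        using w by (intro sums) auto
      ultimately show ?thesis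
        using sums_unique2 by fastforce
    qed
  qed (use that in auto)
  then show ?thesis
    using that[OF cont hol] by (simp add: F_def)
qed

text \<open>The symmetry says that \<open>f\<close> equals its reflection
  \<open>cnj \<circ> f \<circ> cnj\<close>; differentiating this identity hands it on to each
  derivative.\<close>

lemma higher_deriv_cnj:
  assumes hol: "f holomorphic_on ball 0 r" and sym: "\<And>w. norm w < r \<Longrightarrow> f (cnj w) = cnj (f w)"
    and w: "norm w < r"
  shows "(deriv ^^ n) f (cnj w) = cnj ((deriv ^^ n) f w)"
  using w
proof (induction n arbitrary: w)
  case (Suc n)
  let ?h = "(deriv ^^ n) f"
  have "?h holomorphic_on ball 0 r"
    using hol by (intro holomorphic_higher_deriv) auto
  then have "(?h has_field_derivative deriv ?h (cnj w)) (at (cnj w))"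
    using Suc.prems by (intro holomorphic_derivI[where S = "ball 0 r"]) auto
  then have "(cnj \<circ> ?h \<circ> cnj has_field_derivative cnj (deriv ?h (cnj w))) (at w)"
    by (rule has_field_derivative_cnj_cnj)
  then have "(?h has_field_derivative cnj (deriv ?h (cnj w))) (at w)"
    by (rule has_field_derivative_transform_within_open[where S = "ball 0 r"]) (use Suc in auto)
  then show ?case
    using DERIV_imp_deriv by fastforce
qed (use sym in auto)

text \<open>The symmetry forces the Taylor coefficients at 0 to be real, and these form the impulse
  response.\<close>

lemma causal_if_holomorphic:
  assumes hol: "f holomorphic_on ball 0 1" and sym: "\<And>w. norm w < 1 \<Longrightarrow> f (cnj w) = cnj (f w)"
  shows "causal (\<lambda>z. f (1 / z))"
proof -
  define c where "c n = (deriv ^^ n) f 0 / fact n" for n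
  have "cnj (c n) = c n" for n
    using higher_deriv_cnj[OF hol sym, of 0 n] by (simp add: c_def)
  then have c: "of_real (Re (c n)) = c n" for n
    by (metis Reals_cnj_iff of_real_Re)
  have "(\<lambda>n. of_real (Re (c n)) / z ^ n) sums f (1 / z)" if z: "norm z > 1" for z
  proof -
    have "1 / z \<in> ball 0 1"
      using z by (auto simp: norm_divide divide_simps)
    then have "(\<lambda>n. c n * (1 / z - 0) ^ n) sums f (1 / z)"
      using holomorphic_power_series[OF hol] unfolding c_def by blast
    then show ?thesis
      unfolding c by (simp add: power_divide)
  qed
  then show ?thesis
    unfolding causal_def by (intro exI[of _ "\<lambda>n. Re (c n)"]) auto
qed

text \<open>The passage back from the disc to filters. The inverse is causal because 1/f is again
  holomorphic and symmetric, also at 0, which is the filter's point at infinity.\<close>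

lemma stable_minimum_phase_if_disc:
  assumes cont: "continuous_on (cball 0 1) f" and hol: "f holomorphic_on ball 0 1"
    and sym: "\<And>w. norm w < 1 \<Longrightarrow> f (cnj w) = cnj (f w)"
    and nz: "\<And>w. norm w < 1 \<Longrightarrow> f w \<noteq> 0"
  shows "stable_causal (\<lambda>z. f (1 / z))" "minimum_phase (\<lambda>z. f (1 / z))"
proof -
  have causal: "causal (\<lambda>z. f (1 / z))"
    by (rule causal_if_holomorphic[OF hol sym])
  have "continuous_on {z. norm z \<ge> 1} (\<lambda>z. f (1 / z))"
    by (rule continuous_on_compose2[OF cont]) (auto intro!: continuous_intros simp: norm_divide divide_simps)
  then show "stable_causal (\<lambda>z. f (1 / z))"
    using causal by (simp add: stable_causal_def)
  have "causal (\<lambda>z. (\<lambda>w. 1 / f w) (1 / z))"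
    by (rule causal_if_holomorphic) (use hol sym nz in \<open>auto intro!: holomorphic_intros\<close>)
  moreover have "f (1 / z) \<noteq> 0" if "norm z > 1" for z
    using that by (intro nz) (simp add: norm_divide divide_simps)
  ultimately show "minimum_phase (\<lambda>z. f (1 / z))"
    using causal by (simp add: minimum_phase_def)
qed

section \<open>Boundary limits and square roots of the modulus\<close>

lemma continuous_extension_cball:
  fixes f :: "complex \<Rightarrow> complex"
  assumes cont: "continuous_on (ball 0 1) f"
    and lim: "\<And>\<zeta>. norm \<zeta> = 1 \<Longrightarrow> \<exists>l. (f \<longlongrightarrow> l) (at \<zeta> within ball 0 1)"
  obtains g where "continuous_on (cball 0 1) g" "\<And>w. w \<in> ball 0 1 \<Longrightarrow> g w = f w"
proof -
  have at: "atin_within euclidean \<zeta> S = at \<zeta> within S" for \<zeta> :: complex and S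
    by (auto simp: filter_eq_iff eventually_atin_within eventually_at_topological)
  obtain g where "continuous_map (top_of_set (cball 0 1)) euclidean g"
    "\<And>w. w \<in> ball 0 1 \<Longrightarrow> g w = f w"
  proof (rule continuous_map_extension_pointwise_alt[of euclidean "ball 0 1" "cball 0 1" euclidean f])
    show "regular_space (euclidean :: complex topology)"
      using regular_space_euclidean by simp
    show "\<exists>l. limitin euclidean f l (atin_within euclidean t (ball 0 1))" if "t \<in> cball 0 1 - ball 0 1" for t
      using lim[of t] that by (auto simp: at)
  qed (use cont in auto)
  then show ?thesis
    using that by simp
qed

text \<open>Near \<open>\<zeta>\<close> the quotient h/l lies in the right half-plane, so its
  principal logarithm is continuous and has a limit; there it differs from \<open>L\<close> only by
  a constant.\<close>

lemma tendsto_log_at_boundary: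
  assumes h: "h holomorphic_on ball 0 1" and L: "L holomorphic_on ball 0 1"
    and hL: "\<And>w. w \<in> ball 0 1 \<Longrightarrow> h w = exp (L w)"
    and lim: "(h \<longlongrightarrow> l) (at \<zeta> within ball 0 1)" and l: "l \<noteq> 0"
  shows "\<exists>m. (L \<longlongrightarrow> m) (at \<zeta> within ball 0 1)"
proof -
  have "\<forall>\<^sub>F w in at \<zeta> within ball 0 1. dist (h w) l < norm l"
    using tendstoD[OF lim] l by auto
  then obtain d where d: "d > 0"
    "\<And>w. w \<in> ball 0 1 \<Longrightarrow> w \<noteq> \<zeta> \<Longrightarrow> dist w \<zeta> < d \<Longrightarrow> dist (h w) l < norm l"
    by (auto simp: eventually_at)
  define U where "U = ball 0 1 \<inter> ball \<zeta> d - {\<zeta>}"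
  show ?thesis
  proof (cases "\<zeta> \<in> ball 0 1")
    case True
    then have "(L \<longlongrightarrow> L \<zeta>) (at \<zeta> within ball 0 1)"
      using holomorphic_on_imp_continuous_on[OF L] by (simp add: continuous_on_def)
    then show ?thesis
      by blast
  next
    case False
    then have U: "U = ball 0 1 \<inter> ball \<zeta> d"
      by (auto simp: U_def)
    have Re_pos: "Re (h w / l) > 0" if "w \<in> U" for w
    proof -
      have "dist (h w) l < norm l"
        using that by (intro d) (auto simp: U_def dist_commute)
      moreover have "norm (h w / l - 1) = dist (h w) l / norm l"
        using l by (simp add: dist_norm diff_divide_distrib flip: norm_divide)
      ultimately have "norm (h w / l - 1) < 1"
        using l by simp
      then show ?thesis
        using abs_Re_le_cmod[of "h w / l - 1"] by simp
    qed
    then have nonpos: "h w / l \<notin> \<real>\<^sub>\<le>\<^sub>0" if "w \<in> U" for w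
      using that by (force simp: complex_nonpos_Reals_iff)
    define k where "k w = L w - Ln (h w / l)" for w
    have sub: "U \<subseteq> ball 0 1"
      by (auto simp: U_def)
    have hol: "k holomorphic_on U"
      unfolding k_def using nonpos h L sub l
      by (auto intro!: holomorphic_intros intro: holomorphic_on_subset)
    have expk: "exp (k w) = l" if "w \<in> U" for w
    proof -
      have "h w \<noteq> 0"
        using hL[of w] sub that by auto
      then show ?thesis
        using hL[of w] sub that l by (auto simp: k_def exp_diff)
    qed
    \<comment> \<open>Differentiating the constant exp(k) shows that \<open>k\<close> has derivative
      0, and \<open>U\<close> is convex.\<close>
    have "\<exists>c. \<forall>w\<in>U. k w = c"
    proof (rule has_field_derivative_zero_constant)
      show "convex U"
        unfolding U by (intro convex_Int) auto
      show "(k has_field_derivative 0) (at w within U)" if w: "w \<in> U" for w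
      proof -
        have "open U"
          unfolding U by auto
        then have k': "(k has_field_derivative deriv k w) (at w)"
          by (rule holomorphic_derivI[OF hol _ w])
        then have "((\<lambda>w. exp (k w)) has_field_derivative exp (k w) * deriv k w) (at w)"
          by (auto intro!: derivative_eq_intros)
        then have "((\<lambda>w. l) has_field_derivative exp (k w) * deriv k w) (at w)"
          by (rule has_field_derivative_transform_within_open[where S = U]) (use expk w \<open>open U\<close> in auto)
        then have "exp (k w) * deriv k w = 0"
          using DERIV_unique DERIV_const by blast
        then show ?thesis
          using k' by (auto intro: has_field_derivative_at_within)
      qed
    qed
    then obtain c where c: "\<And>w. w \<in> U \<Longrightarrow> k w = c"
      by blast
    have "((\<lambda>w. c + Ln (h w / l)) \<longlongrightarrow> c + Ln (l / l)) (at \<zeta> within ball 0 1)"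
      using l lim by (intro tendsto_intros) (auto simp: complex_nonpos_Reals_iff)
    moreover have "\<forall>\<^sub>F w in at \<zeta> within ball 0 1. c + Ln (h w / l) = L w"
    proof -
      have "c + Ln (h w / l) = L w" if "w \<in> U" for w
        using c[OF that] by (auto simp: k_def)
      then show ?thesis
        using d(1) unfolding eventually_at U by (auto simp: dist_commute)
    qed
    ultimately show ?thesis
      using Lim_transform_eventually by blast
  qed
qed

text \<open>Symmetrising the logarithm of the outer function makes the Taylor coefficients of the
  spectral factor real; this is why the boundary modulus of its fourth power is a product of two
  boundary values of the outer function.\<close>

lemma disc_algebra_spectral_factor:
  assumes cont: "continuous_on (cball 0 1) F" and hol: "F holomorphic_on ball 0 1"
    and sym: "\<And>w. norm w \<le> 1 \<Longrightarrow> F (cnj w) = cnj (F w)"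
    and z0: "norm z0 < 1" "F z0 \<noteq> 0"
  obtains H where "continuous_on (cball 0 1) H" "H holomorphic_on ball 0 1"
    "\<And>w. norm w < 1 \<Longrightarrow> H (cnj w) = cnj (H w)" "\<And>w. norm w < 1 \<Longrightarrow> H w \<noteq> 0"
    "\<And>w. norm w = 1 \<Longrightarrow> (norm (H w))\<^sup>2 = norm (F w)"
proof -
  obtain h where h: "h holomorphic_on ball 0 1" and hnz: "\<And>w. norm w < 1 \<Longrightarrow> h w \<noteq> 0"
    and hlim: "\<And>\<zeta>. norm \<zeta> = 1 \<Longrightarrow> \<exists>l. (h \<longlongrightarrow> l) (at \<zeta> within ball 0 1) \<and> norm l = norm (F \<zeta>)"
    using disc_algebra_outer[OF cont hol z0] by metis
  obtain L where L: "L holomorphic_on ball 0 1" and hL: "\<And>w. w \<in> ball 0 1 \<Longrightarrow> h w = exp (L w)"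
    using contractible_imp_holomorphic_log[OF h] hnz convex_imp_contractible[OF convex_ball]
    by (metis mem_ball_0)
  \<comment> \<open>The quarter combines a half for averaging \<open>L\<close> with its reflection
    and a half for the square root of the modulus.\<close>
  define H0 where "H0 w = exp ((L w + cnj (L (cnj w))) / 4)" for w
  have H0_hol: "H0 holomorphic_on ball 0 1"
  proof -
    have "(cnj \<circ> L \<circ> cnj) holomorphic_on ball 0 1"
      unfolding holomorphic_on_def
    proof
      fix w :: complex assume "w \<in> ball 0 1"
      then have "L field_differentiable (at (cnj w))"
        using L by (intro holomorphic_on_imp_differentiable_at[of L "ball 0 1"]) auto
      then show "(cnj \<circ> L \<circ> cnj) field_differentiable (at w within ball 0 1)"
        by (rule field_differentiable_at_within[OF field_differentiable_cnj_cnj])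
    qed
    then show ?thesis
      unfolding H0_def using L by (auto intro!: holomorphic_intros simp: o_def)
  qed
  have H0_norm: "norm (H0 w) ^ 4 = norm (h w) * norm (h (cnj w))" if "norm w < 1" for w
  proof -
    have "H0 w ^ 4 = exp (of_nat 4 * ((L w + cnj (L (cnj w))) / 4))"
      unfolding H0_def exp_of_nat_mult ..
    also have "of_nat 4 * ((L w + cnj (L (cnj w))) / 4) = L w + cnj (L (cnj w))"
      by simp
    finally have "H0 w ^ 4 = exp (L w + cnj (L (cnj w)))" .
    then have "H0 w ^ 4 = h w * cnj (h (cnj w))"
      using hL[of w] hL[of "cnj w"] that by (simp add: exp_add exp_cnj)
    then show ?thesis
      by (metis norm_power norm_mult complex_mod_cnj)
  qed
  have cnj_lim: "((f \<circ> cnj) \<longlongrightarrow> l) (at \<zeta> within ball 0 1)"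
    if "(f \<longlongrightarrow> l) (at (cnj \<zeta>) within ball 0 1)" for f :: "complex \<Rightarrow> complex" and l \<zeta>
    unfolding o_def
  proof (rule filterlim_compose[OF that])
    show "filterlim cnj (at (cnj \<zeta>) within ball 0 1) (at \<zeta> within ball 0 1)"
      unfolding filterlim_at
      by (auto intro!: tendsto_intros simp: eventually_at_filter)
  qed
  have H0_norm_lim: "((\<lambda>w. norm (H0 w) ^ 4) \<longlongrightarrow> (norm (F \<zeta>))\<^sup>2) (at \<zeta> within ball 0 1)"
    if \<zeta>: "norm \<zeta> = 1" for \<zeta>
  proof -
    obtain l where l: "(h \<longlongrightarrow> l) (at \<zeta> within ball 0 1)" "norm l = norm (F \<zeta>)"
      using hlim[OF \<zeta>] by blast
    obtain l' where l': "(h \<longlongrightarrow> l') (at (cnj \<zeta>) within ball 0 1)" "norm l' = norm (F \<zeta>)"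
      using hlim[of "cnj \<zeta>"] sym[of \<zeta>] \<zeta> by auto
    have "((\<lambda>w. norm (h w) * norm ((h \<circ> cnj) w)) \<longlongrightarrow> norm l * norm l') (at \<zeta> within ball 0 1)"
      by (intro tendsto_intros l cnj_lim l')
    moreover have "\<forall>\<^sub>F w in at \<zeta> within ball 0 1. norm (h w) * norm ((h \<circ> cnj) w) = norm (H0 w) ^ 4"
      using H0_norm by (simp add: eventually_at_filter)
    ultimately show ?thesis
      using l l' by (simp add: tendsto_cong power2_eq_square)
  qed
  obtain H where H: "continuous_on (cball 0 1) H" and HH0: "\<And>w. w \<in> ball 0 1 \<Longrightarrow> H w = H0 w"
  proof (rule continuous_extension_cball[of H0])
    show "continuous_on (ball 0 1) H0"
      by (rule holomorphic_on_imp_continuous_on[OF H0_hol])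
    show "\<exists>l. (H0 \<longlongrightarrow> l) (at \<zeta> within ball 0 1)" if \<zeta>: "norm \<zeta> = 1" for \<zeta>
    proof (cases "F \<zeta> = 0")
      case True
      \<comment> \<open>At a zero of \<open>F\<close> the logarithm diverges, but here convergence
        of the modulus to 0 is enough.\<close>
      have "((\<lambda>w. root 4 (norm (H0 w) ^ 4)) \<longlongrightarrow> root 4 ((norm (F \<zeta>))\<^sup>2)) (at \<zeta> within ball 0 1)"
        by (intro tendsto_intros H0_norm_lim \<zeta>)
      then have "(H0 \<longlongrightarrow> 0) (at \<zeta> within ball 0 1)"
        using True by (simp add: real_root_power_cancel tendsto_norm_zero_iff)
      then show ?thesis ..
    next
      case False
      obtain l where l: "(h \<longlongrightarrow> l) (at \<zeta> within ball 0 1)" "norm l = norm (F \<zeta>)"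
        using hlim[OF \<zeta>] by blast
      obtain l' where l': "(h \<longlongrightarrow> l') (at (cnj \<zeta>) within ball 0 1)" "norm l' = norm (F \<zeta>)"
        using hlim[of "cnj \<zeta>"] sym[of \<zeta>] \<zeta> by auto
      obtain m where m: "(L \<longlongrightarrow> m) (at \<zeta> within ball 0 1)"
        using tendsto_log_at_boundary[OF h L hL l(1)] l(2) False by fastforce
      obtain m' where m': "(L \<longlongrightarrow> m') (at (cnj \<zeta>) within ball 0 1)"
        using tendsto_log_at_boundary[OF h L hL l'(1)] l'(2) False by fastforce
      have "((\<lambda>w. exp ((L w + cnj ((L \<circ> cnj) w)) / 4)) \<longlongrightarrow> exp ((m + cnj m') / 4)) (at \<zeta> within ball 0 1)"
        by (intro tendsto_intros m cnj_lim m') simp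
      then show ?thesis
        unfolding H0_def by auto
    qed
  qed blast
  show ?thesis
  proof
    show "continuous_on (cball 0 1) H"
      by fact
    show "H holomorphic_on ball 0 1"
      using H0_hol HH0 by (metis holomorphic_transform)
    show "H (cnj w) = cnj (H w)" if "norm w < 1" for w
      using that HH0[of w] HH0[of "cnj w"] by (simp add: H0_def exp_cnj add.commute)
    show "H w \<noteq> 0" if "norm w < 1" for w
      using that HH0[of w] by (simp add: H0_def)
    show "(norm (H \<zeta>))\<^sup>2 = norm (F \<zeta>)" if \<zeta>: "norm \<zeta> = 1" for \<zeta>
    proof -
      have "(H \<longlongrightarrow> H \<zeta>) (at \<zeta> within ball 0 1)"
        using H \<zeta> tendsto_within_subset[of H _ \<zeta> "cball 0 1" "ball 0 1"]
        unfolding continuous_on_def by (auto simp: ball_subset_cball)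
      then have "((\<lambda>w. norm (H w) ^ 4) \<longlongrightarrow> norm (H \<zeta>) ^ 4) (at \<zeta> within ball 0 1)"
        by (intro tendsto_intros)
      moreover have "\<forall>\<^sub>F w in at \<zeta> within ball 0 1. norm (H w) ^ 4 = norm (H0 w) ^ 4"
        using HH0 by (simp add: eventually_at_filter)
      ultimately have "((\<lambda>w. norm (H0 w) ^ 4) \<longlongrightarrow> norm (H \<zeta>) ^ 4) (at \<zeta> within ball 0 1)"
        by (simp add: tendsto_cong)
      moreover have "at \<zeta> within ball 0 1 \<noteq> bot"
        using \<zeta> by (simp add: trivial_limit_within islimpt_ball)
      ultimately have "norm (H \<zeta>) ^ 4 = (norm (F \<zeta>))\<^sup>2"
        using H0_norm_lim[OF \<zeta>] tendsto_unique by blast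
      then have "((norm (H \<zeta>))\<^sup>2)\<^sup>2 = (norm (F \<zeta>))\<^sup>2"
        by simp
      then show ?thesis
        by (rule power2_eq_imp_eq) auto
    qed
  qed
qed

section \<open>Moduli on the unit circle\<close>

text \<open>Cauchy's theorem for the difference quotient \<open>g\<close>: on the circle its
  denominator cancels against the derivative of the parametrisation.\<close>

lemma mean_value_circle:
  assumes hol: "f holomorphic_on ball 0 1" and r: "0 < r" "r < 1"
  shows "((\<lambda>t. f (of_real r * cis t)) has_integral of_real (2 * pi) * f 0) {-pi..pi}"
proof -
  define g where "g w = (if w = 0 then deriv f 0 else (f w - f 0) / (w - 0))" for w
  have g: "g holomorphic_on ball 0 1"
    unfolding g_def by (rule pole_lemma[OF hol]) simp
  let ?\<gamma> = "part_circlepath 0 r (-pi) pi"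
  have "(g has_contour_integral 0) ?\<gamma>"
  proof (rule Cauchy_theorem_disc_simple[OF g])
    show "path_image ?\<gamma> \<subseteq> ball 0 1"
      using r path_image_part_circlepath_subset[of "-pi" pi r 0] by (auto simp: subset_iff)
    show "pathfinish ?\<gamma> = pathstart ?\<gamma>"
      by (simp add: exp_minus)
  qed simp
  then have "((\<lambda>t. g (0 + of_real r * cis t) * of_real r * \<i> * cis t) has_integral 0) {-pi..pi}"
    by (subst (asm) has_contour_integral_part_circlepath_iff) auto
  moreover have "g (0 + of_real r * cis t) * of_real r * \<i> * cis t = \<i> * (f (of_real r * cis t) - f 0)" for t
    using r by (simp add: g_def)
  ultimately have "((\<lambda>t. \<i> * (f (of_real r * cis t) - f 0)) has_integral 0) {-pi..pi}"
    by (simp only:)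
  from has_integral_mult_right[OF this, of "-\<i>"]
  have "((\<lambda>t. f (of_real r * cis t) - f 0) has_integral 0) {-pi..pi}"
    by simp
  from has_integral_add[OF this has_integral_const_real[of "f 0" "-pi" pi]]
  show ?thesis
    by (simp add: scaleR_conv_of_real)
qed

text \<open>The mean of ln |f| over every smaller circle is ln |f(0)|. On circles close to the
  boundary ln |f| is below -n over the zero set and at most ln M elsewhere, so n times the measure
  of the zero set stays bounded.\<close>

lemma zeros_on_circle_null:
  assumes cont: "continuous_on (cball 0 1) f" and hol: "f holomorphic_on ball 0 1"
    and nz: "\<And>w. norm w < 1 \<Longrightarrow> f w \<noteq> 0"
  shows "{t \<in> {-pi..pi}. f (cis t) = 0} \<in> null_sets lborel"
proof -
  define E where "E = {t \<in> {-pi..pi}. f (cis t) = 0}"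
  have "continuous_on {-pi..pi} (\<lambda>t. f (cis t))"
    by (rule continuous_on_compose2[OF cont]) (auto intro!: continuous_intros)
  from continuous_closed_preimage_constant[OF this, of 0]
  have "closed E"
    unfolding E_def by simp
  then have E: "E \<in> sets borel"
    by (rule borel_closed)
  have fin: "emeasure lborel E < \<infinity>"
    by (rule emeasure_bounded_finite, rule bounded_subset[of "{-pi..pi}"]) (auto simp: E_def)
  obtain L where L: "L holomorphic_on ball 0 1" and fL: "\<And>w. w \<in> ball 0 1 \<Longrightarrow> f w = exp (L w)"
    using contractible_imp_holomorphic_log[OF hol] nz convex_imp_contractible[OF convex_ball]
    by (metis mem_ball_0)
  have "compact (f ` cball 0 1)"
    using cont by (intro compact_continuous_image) auto
  then obtain M0 where M0: "\<And>w. norm w \<le> 1 \<Longrightarrow> norm (f w) \<le> M0"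
    by (metis bounded_iff compact_imp_bounded image_eqI mem_cball_0)
  \<comment> \<open>Since ln M is nonnegative, the bound -n over \<open>E\<close> may be weakened to
    ln M - n, and one comparison function serves both cases.\<close>
  define M where "M = max 1 M0"
  have M: "M \<ge> 1" "\<And>w. norm w \<le> 1 \<Longrightarrow> norm (f w) \<le> M"
    using M0 by (auto simp: M_def intro: max.coboundedI2)
  have bound: "real n * measure lborel E \<le> 2 * pi * (ln M - Re (L 0))" for n
  proof -
    have "uniformly_continuous_on (cball 0 1) f"
      using cont by (simp add: compact_uniformly_continuous)
    then obtain d where "d > 0"
      and d: "\<And>w w'. norm w \<le> 1 \<Longrightarrow> norm w' \<le> 1 \<Longrightarrow> dist w' w < d \<Longrightarrow> dist (f w') (f w) < exp (- real n)"
      unfolding uniformly_continuous_on_def by (metis exp_gt_zero mem_cball_0)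
    define r where "r = 1 - min d 1 / 2"
    have r: "0 < r" "r < 1" "1 - r < d"
      using \<open>d > 0\<close> by (auto simp: r_def min_def)
    have "((\<lambda>t. Re (L (of_real r * cis t))) has_integral Re (of_real (2 * pi) * L 0)) {-pi..pi}"
      using has_integral_linear[OF mean_value_circle[OF L r(1,2)] bounded_linear_Re] by (simp add: o_def)
    moreover have "((\<lambda>t. ln M - real n * (if t \<in> E then 1 else 0)) has_integral
        (2 * pi * ln M - real n * measure lborel E)) {-pi..pi}"
    proof -
      have "((\<lambda>t. 1) has_integral measure lborel E) E"
        using E fin by (intro has_integral_measure_lborel) auto
      then have "((\<lambda>t. if t \<in> E then 1 else 0) has_integral measure lborel E) {-pi..pi}"
        by (subst has_integral_restrict) (auto simp: E_def)
      from has_integral_diff[OF has_integral_const_real has_integral_mult_right[OF this]]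
      show ?thesis
        by simp
    qed
    moreover have "Re (L (of_real r * cis t)) \<le> ln M - real n * (if t \<in> E then 1 else 0)" for t
    proof -
      let ?w = "of_real r * cis t"
      have w: "norm ?w < 1"
        using r by (simp add: norm_mult)
      then have eq: "norm (f ?w) = exp (Re (L ?w))"
        using fL[of ?w] by simp
      show ?thesis
      proof (cases "t \<in> E")
        case True
        have "dist ?w (cis t) = norm (of_real (r - 1) * cis t)"
          unfolding dist_norm by (simp add: algebra_simps)
        also have "\<dots> < d"
          unfolding norm_mult norm_of_real using r by simp
        finally have "dist (f ?w) (f (cis t)) < exp (- real n)"
          using w by (intro d) auto
        then have "exp (Re (L ?w)) < exp (- real n)"
          using True eq by (simp add: E_def)
        then show ?thesis
          using True ln_ge_zero[OF M(1)] by simp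
      next
        case False
        have "exp (Re (L ?w)) \<le> M"
          using M(2)[of ?w] w eq by simp
        then show ?thesis
          using False M(1) by (simp add: ln_ge_iff)
      qed
    qed
    ultimately have "Re (of_real (2 * pi) * L 0) \<le> 2 * pi * ln M - real n * measure lborel E"
      by (rule has_integral_le)
    then show ?thesis
      by (simp add: algebra_simps)
  qed
  have "measure lborel E = 0"
  proof (rule ccontr)
    assume "measure lborel E \<noteq> 0"
    then have "measure lborel E > 0"
      by (simp add: zero_less_measure_iff)
    then obtain n :: nat where "2 * pi * (ln M - Re (L 0)) < real n * measure lborel E"
      using reals_Archimedean3 by blast
    then show False
      using bound[of n] by simp
  qed
  then show ?thesis
    using E fin unfolding E_def[symmetric] by (intro null_setsI) (auto simp: emeasure_eq_ennreal_measure top.not_eq_extremum)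
qed

text \<open>The interval \<open>{-1..1}\<close> parametrises conjugate pairs on the circle by their real part, so that an
  approximating polynomial in \<open>Re w\<close> becomes, up to a unimodular power of \<open>w\<close>, a polynomial in \<open>w\<close>.\<close>

lemma circle_poly_between:
  fixes u v :: "real \<Rightarrow> real"
  assumes u: "continuous_on {-1..1} u" and v: "continuous_on {-1..1} v"
    and uv: "\<And>x. x \<in> {-1..1} \<Longrightarrow> u x < v x"
  obtains p :: "complex poly" and P :: "real \<Rightarrow> real"
    where "\<And>x. x \<in> {-1..1} \<Longrightarrow> u x < P x \<and> P x < v x"
      "\<And>w. norm w = 1 \<Longrightarrow> norm (poly p w) = \<bar>P (Re w)\<bar>"
proof -
  have "continuous_on {-1..1} (\<lambda>x. v x - u x)"
    by (intro continuous_intros u v)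
  \<comment> \<open>The smallest gap is positive by compactness; approximating the midpoint to
    within half of it stays strictly between \<open>u\<close> and \<open>v\<close>.\<close>
  from continuous_attains_inf[OF _ _ this] obtain x0 where x0: "x0 \<in> {-1..1}"
    "\<And>x. x \<in> {-1..1} \<Longrightarrow> v x0 - u x0 \<le> v x - u x"
    by auto
  have "continuous_on {-1..1} (\<lambda>x. (u x + v x) / 2)"
    by (intro continuous_intros u v) auto
  then obtain P where P: "real_polynomial_function P"
    "\<And>x. x \<in> {-1..1} \<Longrightarrow> \<bar>(u x + v x) / 2 - P x\<bar> < (v x0 - u x0) / 2"
    by (rule Stone_Weierstrass_real_polynomial_function[OF compact_Icc, of _ _ _ "(v x0 - u x0) / 2"])
      (use uv[OF x0(1)] in auto)
  obtain a n where a: "P = (\<lambda>x. \<Sum>i\<le>n. a i * x ^ i)"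
    using P(1) real_polynomial_function_iff_sum by blast
  \<comment> \<open>On the circle (1 + w^2)/2 equals w Re w. The extra power w^(n-i) gives every
    term the same factor w^n, of modulus 1.\<close>
  define p :: "complex poly"
    where "p = (\<Sum>i\<le>n. smult (of_real (a i)) ([:1/2, 0, 1/2:] ^ i * monom 1 (n - i)))"
  show ?thesis
  proof
    show "u x < P x \<and> P x < v x" if "x \<in> {-1..1}" for x
      using P(2)[OF that] x0(2)[OF that] by (auto simp: abs_less_iff field_simps)
    show "norm (poly p w) = \<bar>P (Re w)\<bar>" if w: "norm w = 1" for w
    proof -
      have "w * cnj w = 1"
        using w by (simp add: complex_norm_square[symmetric])
      moreover have "w + cnj w = of_real (2 * Re w)"
        by (rule complex_add_cnj)
      ultimately have "1 + w * w = w * of_real (2 * Re w)"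
        by (metis add.commute distrib_left)
      then have q: "poly [:1/2, 0, 1/2:] w = w * of_real (Re w)"
        by (simp add: field_simps)
      have "poly p w = (\<Sum>i\<le>n. of_real (a i) * ((w * of_real (Re w)) ^ i * w ^ (n - i)))"
        unfolding p_def poly_sum poly_smult poly_mult poly_power q poly_monom by simp
      also have "\<dots> = (\<Sum>i\<le>n. w ^ n * of_real (a i * Re w ^ i))"
        by (intro sum.cong) (auto simp: power_mult_distrib simp flip: power_add)
      also have "\<dots> = w ^ n * of_real (P (Re w))"
        by (simp add: a sum_distrib_left)
      finally show ?thesis
        using w by (simp add: norm_mult norm_power)
    qed
  qed
qed

section \<open>Real polynomials and rational filters\<close>

lemma real_poly_if_symmetric:
  fixes s :: "complex poly"
  assumes "\<And>w. poly s (cnj w) = cnj (poly s w)"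
  obtains r :: "real poly" where "map_poly of_real r = s"
proof -
  have "poly (map_poly cnj s) w = poly s w" for w
    using assms[of w] poly_cnj[of s "cnj w"] by simp
  then have "map_poly cnj s = s"
    by (simp add: poly_eq_poly_eq_iff[symmetric] ext)
  then have "cnj (coeff s i) = coeff s i" for i
    by (metis coeff_map_poly complex_cnj_zero)
  then have "map_poly of_real (map_poly Re s) = s"
    by (intro poly_eqI) (simp add: coeff_map_poly complex_eq_iff)
  then show ?thesis
    using that by blast
qed

text \<open>A fourth root is approximated because the real polynomial is a product of two factors of
  modulus |P| on the circle and its modulus is then squared. The lower margin \<open>e\<close> keeps
  it away from zero there.\<close>

lemma circle_modulus_poly_approx:
  assumes cont: "continuous_on (cball 0 1) F" and sym: "\<And>w. norm w \<le> 1 \<Longrightarrow> F (cnj w) = cnj (F w)"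
    and e: "e > 0"
  obtains r :: "real poly" where "\<And>w. norm w \<le> 1 \<Longrightarrow> poly (map_poly of_real r) w \<noteq> (0 :: complex)"
    "\<And>w :: complex. norm w = 1 \<Longrightarrow> norm (F w) + e \<le> (norm (poly (map_poly of_real r) w))\<^sup>2"
    "\<And>w :: complex. norm w = 1 \<Longrightarrow> (norm (poly (map_poly of_real r) w))\<^sup>2 \<le> norm (F w) + 2 * e"
proof -
  \<comment> \<open>Only the upper half-circle is parametrised; the symmetry of \<open>F\<close>
    covers the lower one.\<close>
  define \<phi> where "\<phi> x = norm (F (Complex x (sqrt (1 - x\<^sup>2))))" for x
  have F\<phi>: "norm (F w) = \<phi> (Re w)" if w: "norm w = 1" for w
  proof -
    have "(Im w)\<^sup>2 = 1 - (Re w)\<^sup>2"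
      using w cmod_power2[of w] by simp
    then have "sqrt (1 - (Re w)\<^sup>2) = \<bar>Im w\<bar>"
      by (metis real_sqrt_abs)
    then have "Complex (Re w) (sqrt (1 - (Re w)\<^sup>2)) \<in> {w, cnj w}"
      by (auto simp: complex_eq_iff)
    then show ?thesis
      using sym[of w] w unfolding \<phi>_def by auto
  qed
  have cont_\<phi>: "continuous_on {-1..1} \<phi>"
    unfolding \<phi>_def
  proof (intro continuous_on_norm continuous_on_compose2[OF cont])
    show "continuous_on {-1..1} (\<lambda>x. Complex x (sqrt (1 - x\<^sup>2)))"
      unfolding Complex_eq by (intro continuous_intros)
    show "(\<lambda>x. Complex x (sqrt (1 - x\<^sup>2))) ` {-1..1} \<subseteq> cball 0 1"
      by (auto simp: cmod_def abs_square_le_1)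
  qed
  have \<phi>0: "\<phi> x \<ge> 0" for x
    by (simp add: \<phi>_def)
  obtain p :: "complex poly" and P :: "real \<Rightarrow> real"
    where P: "\<And>x. x \<in> {-1..1} \<Longrightarrow> root 4 (\<phi> x + e) < P x \<and> P x < root 4 (\<phi> x + 2 * e)"
      and p: "\<And>w. norm w = 1 \<Longrightarrow> norm (poly p w) = \<bar>P (Re w)\<bar>"
  proof (rule circle_poly_between[of "\<lambda>x. root 4 (\<phi> x + e)" "\<lambda>x. root 4 (\<phi> x + 2 * e)"])
  qed (use e cont_\<phi> in \<open>auto intro!: continuous_intros\<close>)
  have P4: "\<phi> x + e \<le> \<bar>P x\<bar> ^ 4" "\<bar>P x\<bar> ^ 4 \<le> \<phi> x + 2 * e" "P x > 0" if x: "x \<in> {-1..1}" for x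
  proof -
    have pos: "root 4 (\<phi> x + e) > 0"
      using \<phi>0[of x] e by simp
    show "P x > 0"
      using P[OF x] pos by linarith
    have "root 4 (\<phi> x + e) ^ 4 \<le> \<bar>P x\<bar> ^ 4"
      by (rule power_mono) (use P[OF x] pos in linarith)+
    moreover have "\<bar>P x\<bar> ^ 4 \<le> root 4 (\<phi> x + 2 * e) ^ 4"
      by (rule power_mono) (use P[OF x] pos in linarith)+
    ultimately show "\<phi> x + e \<le> \<bar>P x\<bar> ^ 4" "\<bar>P x\<bar> ^ 4 \<le> \<phi> x + 2 * e"
      using \<phi>0[of x] e by auto
  qed
  have Re: "Re w \<in> {-1..1}" if "norm w = 1" for w
    using abs_Re_le_cmod[of w] that by auto
  have "p \<noteq> 0"
    using p[of 1] P4(3)[of 1] by auto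
  then obtain q A where q: "\<And>w. norm w < 1 \<Longrightarrow> poly q w \<noteq> 0"
    and pq: "\<And>w. norm w \<le> 1 \<Longrightarrow> poly p w = poly q w * blaschke A w"
    and A: "\<And>a. a \<in># A \<Longrightarrow> norm a < 1 \<and> poly p a = 0"
    using poly_blaschke_factorization by metis
  have norm_q: "norm (poly q w) = \<bar>P (Re w)\<bar>" if "norm w = 1" for w
    using pq[of w] p[of w] norm_blaschke_eq_1[of A w] A that by (simp add: norm_mult)
  then have q_nz: "poly q w \<noteq> 0" if "norm w \<le> 1" for w
    using q[of w] P4(3)[OF Re[of w]] that by (cases "norm w = 1") fastforce+
  \<comment> \<open>The product with the reflected conjugate is symmetric. Conjugate points of the
    circle share their real part, so both factors have the same modulus there.\<close>
  define s where "s = q * map_poly cnj q"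
  have s: "poly s w = poly q w * cnj (poly q (cnj w))" for w
    using poly_cnj[of q "cnj w"] by (simp add: s_def)
  have "poly s (cnj w) = cnj (poly s w)" for w
    by (simp add: s)
  then obtain r :: "real poly" where r: "map_poly of_real r = s"
    by (rule real_poly_if_symmetric)
  have norm_s: "(norm (poly s w))\<^sup>2 = \<bar>P (Re w)\<bar> ^ 4" if "norm w = 1" for w
    using norm_q[of w] norm_q[of "cnj w"] that by (simp add: s norm_mult power4_eq_xxxx power2_eq_square)
  show ?thesis
  proof
    show "poly (map_poly of_real r) w \<noteq> (0 :: complex)" if "norm w \<le> 1" for w
      unfolding r s using q_nz[of w] q_nz[of "cnj w"] that by simp
    show "norm (F w) + e \<le> (norm (poly (map_poly of_real r) w))\<^sup>2" if "norm w = 1" for w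
      unfolding r norm_s[OF that] F\<phi>[OF that] by (rule P4(1)[OF Re[OF that]])
    show "(norm (poly (map_poly of_real r) w))\<^sup>2 \<le> norm (F w) + 2 * e" if "norm w = 1" for w
      unfolding r norm_s[OF that] F\<phi>[OF that] by (rule P4(2)[OF Re[OF that]])
  qed
qed

text \<open>Multiplying by a power of z turns r(1/z) into the reflected polynomial, so a pole can
  lie only at 0.\<close>

lemma rational_tf_poly_inverse:
  fixes r :: "real poly"
  shows "rational_tf (\<lambda>z. poly (map_poly of_real r) (1 / z))"
proof -
  let ?R = "map_poly of_real r :: complex poly"
  have deg: "degree ?R = degree r"
    by (rule degree_map_poly) simp
  have "map_poly of_real (reflect_poly r) = reflect_poly ?R"
    by (intro poly_eqI) (simp add: coeff_map_poly coeff_reflect_poly deg)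
  then have "poly (map_poly of_real (reflect_poly r)) z = z ^ degree r * poly ?R (1 / z)"
    if "norm z \<ge> 1" for z
    using that by (subst \<open>map_poly of_real (reflect_poly r) = _\<close>, subst poly_reflect_poly_nz)
      (auto simp: deg inverse_eq_divide)
  moreover have "poly (map_poly of_real (monom 1 (degree r))) z = z ^ degree r" for z :: complex
    by (simp add: map_poly_monom poly_monom)
  ultimately show ?thesis
    unfolding rational_tf_def
    by (intro exI[of _ "reflect_poly r"] exI[of _ "monom 1 (degree r)"]) auto
qed

section \<open>The mean-squared error\<close>

lemma continuous_frequency_response:
  assumes "stable_causal G"
  shows "continuous_on A (\<lambda>\<omega>. G (cis \<omega>))"
proof -
  have "continuous_on {z. norm z \<ge> 1} G"
    using assms by (simp add: stable_causal_def)
  then show ?thesis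
    by (rule continuous_on_compose2) (auto intro!: continuous_intros)
qed

lemma measurable_frequency_response [measurable]:
  assumes "stable_causal G"
  shows "(\<lambda>\<omega>. cmod (G (cis \<omega>))) \<in> borel_measurable borel"
  by (intro borel_measurable_continuous_onI continuous_on_norm continuous_frequency_response assms)

lemma nn_integral_frequency_response:
  assumes "stable_causal G"
  shows "(\<integral>\<^sup>+\<omega>\<in>{-pi..pi}. ennreal (cmod (G (cis \<omega>))) \<partial>lborel)
    = ennreal (LBINT \<omega>:{-pi..pi}. cmod (G (cis \<omega>)))"
proof -
  have "set_integrable lborel {-pi..pi} (\<lambda>\<omega>. cmod (G (cis \<omega>)))"
    by (intro borel_integrable_atLeastAtMost' continuous_on_norm continuous_frequency_response assms)
  then have int: "integrable lborel (\<lambda>\<omega>. indicator {-pi..pi} \<omega> *\<^sub>R cmod (G (cis \<omega>)))"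
    by (simp add: set_integrable_def)
  have "(\<integral>\<^sup>+\<omega>\<in>{-pi..pi}. ennreal (cmod (G (cis \<omega>))) \<partial>lborel)
      = (\<integral>\<^sup>+\<omega>. ennreal (indicator {-pi..pi} \<omega> *\<^sub>R cmod (G (cis \<omega>))) \<partial>lborel)"
    by (intro nn_integral_cong) (auto simp: indicator_def)
  also have "\<dots> = ennreal (LBINT \<omega>:{-pi..pi}. cmod (G (cis \<omega>)))"
    unfolding set_lebesgue_integral_def by (intro nn_integral_eq_integral int) auto
  finally show ?thesis .
qed

lemma frequency_integral_nonneg: "(LBINT \<omega>:{-pi..pi}. cmod (G (cis \<omega>))) \<ge> 0"
  unfolding set_lebesgue_integral_def by (intro integral_nonneg_AE) auto

lemma zfe_mse_eq:
  "zfe_mse \<delta> \<epsilon> G G1 = ennreal ((kappa \<delta> \<epsilon>)\<^sup>2 / (4 * pi\<^sup>2)) *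
     ((\<integral>\<^sup>+\<omega>\<in>{-pi..pi}. ennreal ((cmod (G1 (cis \<omega>)))\<^sup>2) \<partial>lborel) *
      (\<integral>\<^sup>+\<omega>\<in>{-pi..pi}. ennreal ((cmod (G (cis \<omega>) / G1 (cis \<omega>)))\<^sup>2) \<partial>lborel))"
proof -
  have "ennreal ((kappa \<delta> \<epsilon>)\<^sup>2 / (4 * pi\<^sup>2))
      = ennreal ((kappa \<delta> \<epsilon>)\<^sup>2) * ennreal (1 / (2 * pi)) * ennreal (1 / (2 * pi))"
    by (simp add: ennreal_mult[symmetric] power2_eq_square)
  then show ?thesis
    unfolding zfe_mse_def h2_norm_def ennreal_sqrt_power2 by (simp add: mult_ac)
qed

section \<open>Lower bound and attainment\<close>

lemma ennreal_zfe_bound: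
  assumes "stable_causal G"
  shows "ennreal (zfe_bound \<delta> \<epsilon> G) = ennreal ((kappa \<delta> \<epsilon>)\<^sup>2 / (4 * pi\<^sup>2)) *
     (\<integral>\<^sup>+\<omega>\<in>{-pi..pi}. ennreal (cmod (G (cis \<omega>))) \<partial>lborel)\<^sup>2"
  unfolding nn_integral_frequency_response[OF assms] zfe_bound_def
  using frequency_integral_nonneg[of G]
  by (simp add: ennreal_power ennreal_mult[symmetric] power_mult_distrib power_divide)

text \<open>In the disc picture a minimum phase filter has no zeros in the open disc, and then its
  zeros on the circle form a null set.\<close>

lemma AE_minimum_phase_nonzero:
  assumes "stable_causal G1" "minimum_phase G1"
  shows "AE \<omega> in lborel. \<omega> \<in> {-pi..pi} \<longrightarrow> G1 (cis \<omega>) \<noteq> 0"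
proof -
  obtain F where F: "continuous_on (cball 0 1) F" "F holomorphic_on ball 0 1"
    "\<And>w. norm w \<le> 1 \<Longrightarrow> w \<noteq> 0 \<Longrightarrow> F w = G1 (1 / w)"
    and sym: "\<And>w. norm w \<le> 1 \<Longrightarrow> F (cnj w) = cnj (F w)"
    using stable_causal_disc[OF assms(1)] by metis
  \<comment> \<open>Inversion on the circle is conjugation, so \<open>F (cis t)\<close> is the value
    of \<open>G1\<close> at the conjugate point; symmetry makes the moduli agree.\<close>
  have F_cis: "cmod (F (cis t)) = cmod (G1 (cis t))" for t
  proof -
    have "F (cnj (cis t)) = G1 (cis t)"
      using F(3)[of "cis (- t)"] by (simp add: cis_cnj divide_inverse)
    then show ?thesis
      using sym[of "cis t"] by (metis complex_mod_cnj norm_cis order_refl)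
  qed
  have nz: "F w \<noteq> 0" if w: "norm w < 1" "w \<noteq> 0" for w
  proof -
    have "norm (1 / w) > 1"
      using w by (simp add: norm_divide divide_simps)
    then show ?thesis
      using F(3)[of w] assms(2) w by (simp add: minimum_phase_def)
  qed
  \<comment> \<open>0 stands for infinity: the causal inverse supplies a continuous \<open>h\<close>
    with F h = 1 on the punctured disc, and this persists at 0.\<close>
  have "F 0 \<noteq> 0"
  proof -
    obtain g :: "nat \<Rightarrow> real" where g: "\<And>z. norm z > 1 \<Longrightarrow> (\<lambda>k. of_real (g k) / z ^ k) sums (1 / G1 z)"
      using assms(2) unfolding minimum_phase_def causal_def by blast
    define h where "h w = (if w = 0 then of_real (g 0) else 1 / F w)" for w
    have "(\<lambda>k. of_real (g k) * (w - 0) ^ k) sums h w" if "w \<in> ball 0 1" for w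
    proof (cases "w = 0")
      case True
      then show ?thesis
        using powser_sums_zero[of "\<lambda>k. of_real (g k)"] by (simp add: h_def)
    next
      case False
      then show ?thesis
        using g[of "1 / w"] F(3)[of w] that by (simp add: h_def norm_divide field_simps power_divide)
    qed
    then have "h holomorphic_on ball 0 1"
      by (rule power_series_holomorphic)
    then have "isCont h 0"
      by (intro continuous_on_interior[of "ball 0 1"] holomorphic_on_imp_continuous_on) auto
    moreover have "isCont F 0"
      by (rule continuous_on_interior[OF F(1)]) auto
    ultimately have "((\<lambda>w. F w * h w) \<longlongrightarrow> F 0 * h 0) (at 0)"
      by (auto intro!: tendsto_intros simp: isCont_def)
    moreover have "\<forall>\<^sub>F w in at 0. F w * h w = 1"
      unfolding eventually_at using nz by (intro exI[of _ 1]) (auto simp: h_def)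
    ultimately have "((\<lambda>w. 1) \<longlongrightarrow> F 0 * h 0) (at (0 :: complex))"
      using tendsto_cong by fastforce
    then have "F 0 * h 0 = 1"
      by (simp add: tendsto_const_iff)
    then show ?thesis
      by auto
  qed
  then have "{t \<in> {-pi..pi}. F (cis t) = 0} \<in> null_sets lborel"
    using nz by (intro zeros_on_circle_null F) metis
  then show ?thesis
    by (rule AE_I') (use F_cis in \<open>auto simp: set_eq_iff\<close>, metis norm_eq_zero)
qed

text \<open>Cauchy-Schwarz for |G1| and |G/G1| in extended nonnegative integrals, so an infinite
  error is included. Their product is |G| almost everywhere: at zeros of \<open>G1\<close> the
  quotient defaults to 0.\<close>

lemma zfe_bound_le_mse:
  assumes G: "stable_causal G" and G1: "stable_causal G1" "minimum_phase G1"
  shows "ennreal (zfe_bound \<delta> \<epsilon> G) \<le> zfe_mse \<delta> \<epsilon> G G1"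
proof -
  note [measurable] = measurable_frequency_response[OF G] measurable_frequency_response[OF G1(1)]
  define a where "a \<omega> = ennreal (cmod (G1 (cis \<omega>))) * indicator {-pi..pi} \<omega>" for \<omega>
  define b where "b \<omega> = ennreal (cmod (G (cis \<omega>) / G1 (cis \<omega>))) * indicator {-pi..pi} \<omega>" for \<omega>
  have [measurable]: "a \<in> borel_measurable lborel" "b \<in> borel_measurable lborel"
    unfolding a_def b_def norm_divide by measurable
  have "(\<integral>\<^sup>+\<omega>\<in>{-pi..pi}. ennreal (cmod (G (cis \<omega>))) \<partial>lborel) = (\<integral>\<^sup>+\<omega>. a \<omega> * b \<omega> \<partial>lborel)"
    using AE_minimum_phase_nonzero[OF G1]
    by (intro nn_integral_cong_AE, eventually_elim)
      (auto simp: a_def b_def indicator_def norm_divide ennreal_mult[symmetric])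
  moreover have "(\<integral>\<^sup>+\<omega>. a \<omega> ^ 2 \<partial>lborel) = (\<integral>\<^sup>+\<omega>\<in>{-pi..pi}. ennreal ((cmod (G1 (cis \<omega>)))\<^sup>2) \<partial>lborel)"
    by (intro nn_integral_cong) (auto simp: a_def indicator_def ennreal_power)
  moreover have "(\<integral>\<^sup>+\<omega>. b \<omega> ^ 2 \<partial>lborel)
      = (\<integral>\<^sup>+\<omega>\<in>{-pi..pi}. ennreal ((cmod (G (cis \<omega>) / G1 (cis \<omega>)))\<^sup>2) \<partial>lborel)"
    by (intro nn_integral_cong) (auto simp: b_def indicator_def ennreal_power)
  ultimately show ?thesis
    unfolding zfe_mse_eq ennreal_zfe_bound[OF G]
    using Cauchy_Schwarz_nn_integral[of a lborel b] by (auto intro!: mult_left_mono)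
qed

text \<open>The equality case of Cauchy-Schwarz: both integrands are multiples of |G|, and the
  factors \<open>lam\<close> and \<open>1 / lam\<close> cancel.\<close>

lemma zfe_mse_eq_bound:
  assumes G: "stable_causal G" and lam: "lam > 0"
    and G1: "\<And>\<omega>. \<omega> \<in> {-pi..<pi} \<Longrightarrow> (cmod (G1 (cis \<omega>)))\<^sup>2 = lam * cmod (G (cis \<omega>))"
  shows "zfe_mse \<delta> \<epsilon> G G1 = ennreal (zfe_bound \<delta> \<epsilon> G)"
proof -
  note [measurable] = measurable_frequency_response[OF G]
  let ?I = "\<integral>\<^sup>+\<omega>\<in>{-pi..pi}. ennreal (cmod (G (cis \<omega>))) \<partial>lborel"
  \<comment> \<open>The frequencies -pi and pi give the same point of the circle, so the half-open
    interval can be closed.\<close>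
  have eq: "(cmod (G1 (cis \<omega>)))\<^sup>2 = lam * cmod (G (cis \<omega>))" if "\<omega> \<in> {-pi..pi}" for \<omega>
  proof (cases "\<omega> = pi")
    case True
    have "cis pi = cis (-pi)"
      by (simp add: complex_eq_iff)
    then show ?thesis
      using G1[of "-pi"] True by simp
  qed (use G1 that in auto)
  have "(\<integral>\<^sup>+\<omega>\<in>{-pi..pi}. ennreal ((cmod (G1 (cis \<omega>)))\<^sup>2) \<partial>lborel)
      = (\<integral>\<^sup>+\<omega>. ennreal lam * (ennreal (cmod (G (cis \<omega>))) * indicator {-pi..pi} \<omega>) \<partial>lborel)"
    using lam eq by (intro nn_integral_cong) (auto simp: indicator_def ennreal_mult)
  also have "\<dots> = ennreal lam * ?I"
    by (rule nn_integral_cmult) measurable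
  finally have 1: "(\<integral>\<^sup>+\<omega>\<in>{-pi..pi}. ennreal ((cmod (G1 (cis \<omega>)))\<^sup>2) \<partial>lborel) = ennreal lam * ?I" .
  \<comment> \<open>Where \<open>G\<close> vanishes so does \<open>G1\<close>, and 0 / 0 = 0 agrees
    with the right-hand side.\<close>
  have quot: "(cmod (G (cis \<omega>) / G1 (cis \<omega>)))\<^sup>2 = 1 / lam * cmod (G (cis \<omega>))" if "\<omega> \<in> {-pi..pi}" for \<omega>
    using lam by (simp add: norm_divide power_divide eq[OF that]) (simp add: power2_eq_square)
  have "(\<integral>\<^sup>+\<omega>\<in>{-pi..pi}. ennreal ((cmod (G (cis \<omega>) / G1 (cis \<omega>)))\<^sup>2) \<partial>lborel)
      = (\<integral>\<^sup>+\<omega>. ennreal (1 / lam) * (ennreal (cmod (G (cis \<omega>))) * indicator {-pi..pi} \<omega>) \<partial>lborel)"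
  proof (intro nn_integral_cong)
    fix \<omega>
    show "ennreal ((cmod (G (cis \<omega>) / G1 (cis \<omega>)))\<^sup>2) * indicator {-pi..pi} \<omega>
        = ennreal (1 / lam) * (ennreal (cmod (G (cis \<omega>))) * indicator {-pi..pi} \<omega>)"
    proof (cases "\<omega> \<in> {-pi..pi}")
      case True
      show ?thesis
        unfolding quot[OF True] using lam True by (simp add: ennreal_mult[symmetric])
    qed simp
  qed
  also have "\<dots> = ennreal (1 / lam) * ?I"
    by (rule nn_integral_cmult) measurable
  finally have 2: "(\<integral>\<^sup>+\<omega>\<in>{-pi..pi}. ennreal ((cmod (G (cis \<omega>) / G1 (cis \<omega>)))\<^sup>2) \<partial>lborel)
      = ennreal (1 / lam) * ?I" .
  have "(ennreal lam * ?I) * (ennreal (1 / lam) * ?I) = (ennreal lam * ennreal (1 / lam)) * ?I\<^sup>2"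
    by (simp add: power2_eq_square mult_ac)
  also have "ennreal lam * ennreal (1 / lam) = 1"
    using lam by (simp add: ennreal_mult[symmetric])
  finally have "(ennreal lam * ?I) * (ennreal (1 / lam) * ?I) = ?I\<^sup>2"
    by simp
  then show ?thesis
    unfolding zfe_mse_eq ennreal_zfe_bound[OF G] 1 2 by simp
qed

text \<open>The spectral factor of the disc function, scaled by \<open>sqrt lam\<close>. A vanishing
  \<open>G\<close> is excluded, as it would prescribe modulus 0 on the whole circle, while a stable
  minimum phase filter has only a null set of zeros there.\<close>

lemma spectral_factor_exists:
  assumes G: "stable_causal G" and z: "norm z \<ge> 1" "G z \<noteq> 0" and lam: "lam > 0"
  shows "\<exists>G1. stable_causal G1 \<and> minimum_phase G1 \<and>
    (\<forall>\<omega>. (cmod (G1 (cis \<omega>)))\<^sup>2 = lam * cmod (G (cis \<omega>)))"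
proof -
  obtain F where F: "continuous_on (cball 0 1) F" "F holomorphic_on ball 0 1"
    "\<And>w. norm w \<le> 1 \<Longrightarrow> F (cnj w) = cnj (F w)"
    "\<And>w. norm w \<le> 1 \<Longrightarrow> w \<noteq> 0 \<Longrightarrow> F w = G (1 / w)"
    using stable_causal_disc[OF G] by metis
  have "z \<noteq> 0" "norm (1 / z) \<le> 1"
    using z by (auto simp: norm_divide divide_simps)
  then have "F (1 / z) \<noteq> 0"
    using F(4)[of "1 / z"] z by simp
  \<comment> \<open>If \<open>F\<close> vanished on the open disc, it would vanish on the closed
    disc by continuity.\<close>
  then obtain z0 where z0: "norm z0 < 1" "F z0 \<noteq> 0"
    using continuous_constant_on_closure[of "ball 0 1" F 0 "1 / z"] F(1) \<open>norm (1 / z) \<le> 1\<close> by auto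
  obtain H where H: "continuous_on (cball 0 1) H" "H holomorphic_on ball 0 1"
    "\<And>w. norm w < 1 \<Longrightarrow> H (cnj w) = cnj (H w)" "\<And>w. norm w < 1 \<Longrightarrow> H w \<noteq> 0"
    "\<And>w. norm w = 1 \<Longrightarrow> (norm (H w))\<^sup>2 = norm (F w)"
    using disc_algebra_spectral_factor[OF F(1-3) z0] by metis
  define f where "f w = of_real (sqrt lam) * H w" for w
  have "stable_causal (\<lambda>z. f (1 / z))" "minimum_phase (\<lambda>z. f (1 / z))"
    by (rule stable_minimum_phase_if_disc;
        use H lam in \<open>auto simp: f_def intro!: holomorphic_intros continuous_intros\<close>)+
  moreover have "(cmod (f (1 / cis \<omega>)))\<^sup>2 = lam * cmod (G (cis \<omega>))" for \<omega>
  proof -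
    have "norm (1 / cis \<omega>) = 1"
      by (simp add: norm_divide)
    then show ?thesis
      using H(5)[of "1 / cis \<omega>"] F(4)[of "1 / cis \<omega>"] lam
      by (simp add: f_def norm_mult power_mult_distrib)
  qed
  ultimately show ?thesis
    by blast
qed

text \<open>\<open>G1\<close> is chosen with |G| + e \<le> |G1|^2 \<le> |G| + 2e on the circle. The
  upper estimate controls the first integral, and the lower one gives |G/G1|^2 \<le> |G| for the
  second.\<close>

lemma rational_filter_near_bound:
  assumes G: "stable_causal G" and \<eta>: "\<eta> > 0"
  shows "\<exists>G1. stable_causal G1 \<and> minimum_phase G1 \<and> rational_tf G1 \<and>
    zfe_mse \<delta> \<epsilon> G G1 \<le> ennreal (zfe_bound \<delta> \<epsilon> G + \<eta>)"
proof -
  note [measurable] = measurable_frequency_response[OF G]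
  define I where "I = (LBINT \<omega>:{-pi..pi}. cmod (G (cis \<omega>)))"
  have I: "I \<ge> 0"
    unfolding I_def by (rule frequency_integral_nonneg)
  have nn_I: "(\<integral>\<^sup>+\<omega>\<in>{-pi..pi}. ennreal (cmod (G (cis \<omega>))) \<partial>lborel) = ennreal I"
    unfolding I_def by (rule nn_integral_frequency_response[OF G])
  define k where "k = (kappa \<delta> \<epsilon>)\<^sup>2"
  have k: "k \<ge> 0"
    by (simp add: k_def)
  \<comment> \<open>The excess over the bound comes out as k I e / pi, which this choice turns into
    \<open>\<eta>\<close> times k I / (k I + 1); the added 1 keeps the denominator positive when
    \<open>k * I = 0\<close>.\<close>
  define e where "e = \<eta> * pi / (k * I + 1)"
  have kI: "k * I \<ge> 0"
    using k I by simp
  then have e: "e > 0"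
    using \<eta> by (auto simp: e_def intro!: divide_pos_pos)
  obtain F where F: "continuous_on (cball 0 1) F"
    "\<And>w. norm w \<le> 1 \<Longrightarrow> F (cnj w) = cnj (F w)"
    "\<And>w. norm w \<le> 1 \<Longrightarrow> w \<noteq> 0 \<Longrightarrow> F w = G (1 / w)"
    using stable_causal_disc[OF G] by metis
  obtain r :: "real poly" where r: "\<And>w. norm w \<le> 1 \<Longrightarrow> poly (map_poly of_real r) w \<noteq> (0 :: complex)"
    "\<And>w :: complex. norm w = 1 \<Longrightarrow> norm (F w) + e \<le> (norm (poly (map_poly of_real r) w))\<^sup>2"
    "\<And>w :: complex. norm w = 1 \<Longrightarrow> (norm (poly (map_poly of_real r) w))\<^sup>2 \<le> norm (F w) + 2 * e"
    using circle_modulus_poly_approx[OF F(1,2) e] by metis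
  define R where "R = (map_poly of_real r :: complex poly)"
  define G1 where "G1 z = poly R (1 / z)" for z
  have "poly R (cnj w) = cnj (poly R w)" for w
    unfolding R_def by (rule poly_cnj_real[symmetric]) (simp add: coeff_map_poly)
  then have "stable_causal G1" "minimum_phase G1"
    unfolding G1_def using r(1)
    by (auto intro!: stable_minimum_phase_if_disc continuous_intros holomorphic_intros simp: R_def)
  moreover have "rational_tf G1"
    unfolding G1_def R_def by (rule rational_tf_poly_inverse)
  moreover have "zfe_mse \<delta> \<epsilon> G G1 \<le> ennreal (zfe_bound \<delta> \<epsilon> G + \<eta>)"
  proof -
    have G1_ge: "cmod (G (cis \<omega>)) + e \<le> (cmod (G1 (cis \<omega>)))\<^sup>2"
      and G1_le: "(cmod (G1 (cis \<omega>)))\<^sup>2 \<le> cmod (G (cis \<omega>)) + 2 * e" for \<omega>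
      using r(2)[of "1 / cis \<omega>"] r(3)[of "1 / cis \<omega>"] F(3)[of "1 / cis \<omega>"]
      by (simp_all add: G1_def R_def norm_divide)
    have "(\<integral>\<^sup>+\<omega>\<in>{-pi..pi}. ennreal ((cmod (G1 (cis \<omega>)))\<^sup>2) \<partial>lborel)
        \<le> (\<integral>\<^sup>+\<omega>. ennreal (cmod (G (cis \<omega>))) * indicator {-pi..pi} \<omega>
              + ennreal (2 * e) * indicator {-pi..pi} \<omega> \<partial>lborel)"
      using G1_le e by (intro nn_integral_mono) (auto simp: indicator_def ennreal_plus[symmetric] simp del: ennreal_plus intro: ennreal_leI)
    also have "\<dots> = ennreal I + ennreal (2 * e) * ennreal (2 * pi)"
      by (subst nn_integral_add) (auto simp: nn_I nn_integral_cmult_indicator)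
    also have "\<dots> = ennreal (I + 4 * pi * e)"
      using I e by (simp add: ennreal_mult[symmetric] ennreal_plus[symmetric] mult_ac del: ennreal_plus)
    finally have 1: "(\<integral>\<^sup>+\<omega>\<in>{-pi..pi}. ennreal ((cmod (G1 (cis \<omega>)))\<^sup>2) \<partial>lborel) \<le> ennreal (I + 4 * pi * e)" .
    have quot: "(cmod (G (cis \<omega>) / G1 (cis \<omega>)))\<^sup>2 \<le> cmod (G (cis \<omega>))" for \<omega>
    proof -
      have pos: "(cmod (G1 (cis \<omega>)))\<^sup>2 > 0"
        using G1_ge[of \<omega>] e norm_ge_zero[of "G (cis \<omega>)"] by linarith
      have "(cmod (G (cis \<omega>)))\<^sup>2 \<le> cmod (G (cis \<omega>)) * (cmod (G1 (cis \<omega>)))\<^sup>2"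
        unfolding power2_eq_square[of "cmod (G (cis \<omega>))"]
        using G1_ge[of \<omega>] e by (intro mult_left_mono) auto
      then show ?thesis
        using pos by (simp add: norm_divide power_divide pos_divide_le_eq)
    qed
    have 2: "(\<integral>\<^sup>+\<omega>\<in>{-pi..pi}. ennreal ((cmod (G (cis \<omega>) / G1 (cis \<omega>)))\<^sup>2) \<partial>lborel) \<le> ennreal I"
      unfolding nn_I[symmetric] using quot
      by (intro nn_integral_mono mult_right_mono ennreal_leI) auto
    have "zfe_mse \<delta> \<epsilon> G G1 \<le> ennreal (k / (4 * pi\<^sup>2)) * (ennreal (I + 4 * pi * e) * ennreal I)"
      unfolding zfe_mse_eq k_def by (intro mult_left_mono mult_mono 1 2) auto
    also have "\<dots> = ennreal (k / (4 * pi\<^sup>2) * ((I + 4 * pi * e) * I))"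
      using k I e by (simp add: ennreal_mult[symmetric] del: ennreal_plus)
    also have "\<dots> \<le> ennreal (zfe_bound \<delta> \<epsilon> G + \<eta>)"
    proof (rule ennreal_leI)
      have "k / (4 * pi\<^sup>2) * ((I + 4 * pi * e) * I) = zfe_bound \<delta> \<epsilon> G + k * I * e / pi"
        unfolding zfe_bound_def k_def[symmetric] I_def[symmetric]
        by (simp add: field_simps power2_eq_square)
      moreover have "k * I * e / pi = \<eta> * (k * I / (k * I + 1))"
        by (simp add: e_def)
      moreover have "\<eta> * (k * I / (k * I + 1)) \<le> \<eta> * 1"
        using \<eta> kI by (intro mult_left_mono) auto
      ultimately show "k / (4 * pi\<^sup>2) * ((I + 4 * pi * e) * I) \<le> zfe_bound \<delta> \<epsilon> G + \<eta>"
        by simp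
    qed
    finally show ?thesis .
  qed
  ultimately show ?thesis
    by blast
qed

text \<open>Attainment consists of two claims: every admissible filter with the prescribed modulus
  reaches the bound, and such a filter exists unless \<open>G\<close> vanishes outside the open
  disc, where the prescription would contradict minimum phase.\<close>

theorem theorem8:
  fixes \<epsilon> \<delta> :: real and G :: "complex \<Rightarrow> complex"
  assumes "\<epsilon> > 0" and "0 < \<delta>" and "\<delta> < 1" and "stable_causal G"
  shows "(\<forall>G1. stable_causal G1 \<and> minimum_phase G1 \<longrightarrow>
            zfe_mse \<delta> \<epsilon> G G1 \<ge> ennreal (zfe_bound \<delta> \<epsilon> G))
    \<and> (\<forall>lam::real. lam > 0 \<longrightarrow>
          (\<forall>G1. stable_causal G1 \<and> minimum_phase G1 \<and>
             (\<forall>\<omega>\<in>{-pi..<pi}. (cmod (G1 (cis \<omega>)))\<^sup>2 = lam * cmod (G (cis \<omega>))) \<longrightarrow>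
             zfe_mse \<delta> \<epsilon> G G1 = ennreal (zfe_bound \<delta> \<epsilon> G))
        \<and> ((\<exists>z. norm z \<ge> 1 \<and> G z \<noteq> 0) \<longrightarrow>
             (\<exists>G1. stable_causal G1 \<and> minimum_phase G1 \<and>
                (\<forall>\<omega>\<in>{-pi..<pi}. (cmod (G1 (cis \<omega>)))\<^sup>2 = lam * cmod (G (cis \<omega>))))))
    \<and> (\<forall>\<eta>::real. \<eta> > 0 \<longrightarrow>
          (\<exists>G1. stable_causal G1 \<and> minimum_phase G1 \<and> rational_tf G1 \<and>
             zfe_mse \<delta> \<epsilon> G G1 \<le> ennreal (zfe_bound \<delta> \<epsilon> G + \<eta>)))"
proof (intro conjI allI impI)
  fix G1 assume "stable_causal G1 \<and> minimum_phase G1"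
  then show "zfe_mse \<delta> \<epsilon> G G1 \<ge> ennreal (zfe_bound \<delta> \<epsilon> G)"
    using zfe_bound_le_mse assms(4) by blast
next
  fix lam :: real and G1
  assume "lam > 0" and "stable_causal G1 \<and> minimum_phase G1 \<and>
    (\<forall>\<omega>\<in>{-pi..<pi}. (cmod (G1 (cis \<omega>)))\<^sup>2 = lam * cmod (G (cis \<omega>)))"
  then show "zfe_mse \<delta> \<epsilon> G G1 = ennreal (zfe_bound \<delta> \<epsilon> G)"
    by (intro zfe_mse_eq_bound[OF assms(4)]) auto
next
  fix lam :: real
  assume "lam > 0" and "\<exists>z. norm z \<ge> 1 \<and> G z \<noteq> 0"
  then show "\<exists>G1. stable_causal G1 \<and> minimum_phase G1 \<and>
      (\<forall>\<omega>\<in>{-pi..<pi}. (cmod (G1 (cis \<omega>)))\<^sup>2 = lam * cmod (G (cis \<omega>)))"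
    using spectral_factor_exists[OF assms(4)] by blast
next
  fix \<eta> :: real
  assume "\<eta> > 0"
  then show "\<exists>G1. stable_causal G1 \<and> minimum_phase G1 \<and> rational_tf G1 \<and>
      zfe_mse \<delta> \<epsilon> G G1 \<le> ennreal (zfe_bound \<delta> \<epsilon> G + \<eta>)"
    by (rule rational_filter_near_bound[OF assms(4)])
qed

end
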